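(* For every stage $p\in\{0,1,\dots,N\}$ and every dimension $q\ge 0$, the family $\mathcal B_q(p)=\{[z_i]_p \mid i\in\mathcal A_q(p)\}$ is a basis of $H_q(K^p;\Bbbk)$.
   Context: $K$ is a finite CW complex with fixed cell orientations and set of open cells $\mathcal K$; $\Bbbk$ is a field. $C_q$, $\partial_q$, $H_q$ denote cellular chains, boundary and homology with coefficients in $\Bbbk$. A filtration function $f:\mathcal K\to\mathbb R$ is fixed, i.e. $\tau\subseteq\overline\sigma$ implies $f(\tau)\le f(\sigma)$. The cells are totally ordered $\sigma_1\prec\dots\prec\sigma_N$ so that $f(\sigma_i)<f(\sigma_j)$ implies $i<j$, and $\sigma_i\subseteq\overline{\sigma_j}$, $\sigma_i\ne\sigma_j$ implies $i<j$. Put $K^0=\varnothing$, $K^p=\bigcup_{\ell\le p}\sigma_\ell$; each $K^p$ is a CW subcomplex. The boundary matrix $D\in\Bbbk^{N\times N}$ has entries $D_{ij}=[\sigma_j:\sigma_i]$ (cellular incidence coefficients), so its $j$-th column is the coordinate vector of $\partial\sigma_j$; it is strictly upper triangular and $D^2=0$. For a nonzero column $c$, $\operatorname{low}(c)=\max\{i\mid c_i\neq 0\}$. A matrix is reduced if no two of its nonzero columns have the same low. Fix a factorization $R=DV$ with $R$ reduced and $V$ upper unitriangular and dimension preserving (column $V_i$ is supported only on cells of the same dimension as $\sigma_i$). Subscripts on matrices denote columns; columns are identified with cellular chains. A cell $\sigma_i$ is positive if $R_i=0$ and negative otherwise. For a positive $q$-cell $\sigma_i$ the selected birth cycle is $z_i=\sum_{\ell\le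 i,\ \dim\sigma_\ell=q}V_{\ell i}\sigma_\ell$ (i.e. $V_i$); it is a $q$-cycle in $K^i$, and $[z_i]_p$ is its class in $H_q(K^p;\Bbbk)$ for $p\ge i$. For positive $\sigma_i$, $\operatorname{pair}(i)=j$ if $\operatorname{low}(R_j)=i$ for some (necessarily unique) $j$ with $R_j\neq 0$, and $\operatorname{pair}(i)=\infty$ if no such $j$ exists. The active set is $\mathcal A_q(p)=\{i \mid \dim\sigma_i=q,\ R_i=0,\ i\le p<\operatorname{pair}(i)\}$. *)

theory Defs
  imports
    "HOL-Homology.Homology"
    "HOL-Library.Extended_Nat"
    "Jordan_Normal_Form.VS_Connect"
begin

section \<open>Finite CW complexes\<close>

text \<open>The standard closed \<open>n\<close>-disc lives in \<^const>\<open>Euclidean_space\<close>, the library's model of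
  \<open>n\<close>-space as sequences vanishing from index \<open>n\<close> on.  For \<open>n = 0\<close> the disc is a point and its
  boundary sphere is empty.\<close>

definition std_disc :: "nat \<Rightarrow> (nat \<Rightarrow> real) topology" where
  "std_disc n = subtopology (Euclidean_space n) {x. (\<Sum>i<n. (x i)\<^sup>2) \<le> 1}"

definition std_open_disc :: "nat \<Rightarrow> (nat \<Rightarrow> real) set" where
  "std_open_disc n = {x \<in> topspace (std_disc n). (\<Sum>i<n. (x i)\<^sup>2) < 1}"

definition std_sphere :: "nat \<Rightarrow> (nat \<Rightarrow> real) set" where
  "std_sphere n = {x \<in> topspace (std_disc n). (\<Sum>i<n. (x i)\<^sup>2) = 1}"

text \<open>Open cells are represented by the subsets of the space that they are.  The orientation of
  an \<open>n\<close>-cell is a generator of the infinite cyclic group \<open>H\<^sub>n(D\<^sup>n, S\<^sup>n\<^sup>-\<^sup>1)\<close> of integral singular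
  homology, transported to the cell by its characteristic map.\<close>

record 'a cw_complex =
  space :: "'a topology"
  cells :: "'a set set"
  cell_dim :: "'a set \<Rightarrow> nat"
  char_map :: "'a set \<Rightarrow> (nat \<Rightarrow> real) \<Rightarrow> 'a"
  orientation :: "'a set \<Rightarrow> (nat \<Rightarrow> real) chain set"

text \<open>Skeleta are indexed by integers, so that the skeleta of negative index are empty.\<close>

definition skeleton :: "'a cw_complex \<Rightarrow> int \<Rightarrow> 'a set" where
  "skeleton K m = \<Union>{s \<in> cells K. int (cell_dim K s) \<le> m}"

text \<open>For finitely many cells the closure-finiteness and weak topology axioms are automatic.\<close>

definition finite_cw_complex :: "'a cw_complex \<Rightarrow> bool" where
  "finite_cw_complex K \<longleftrightarrow>
     Hausdorff_space (space K) \<and>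
     finite (cells K) \<and> disjoint (cells K) \<and> \<Union>(cells K) = topspace (space K) \<and>
     (\<forall>s \<in> cells K. let n = cell_dim K s; \<Phi> = char_map K s;
                        G = relative_homology_group (int n) (std_disc n) (std_sphere n) in
        continuous_map (std_disc n) (space K) \<Phi> \<and>
        homeomorphic_map (subtopology (std_disc n) (std_open_disc n))
          (subtopology (space K) s) \<Phi> \<and>
        \<Phi> ` std_sphere n \<subseteq> skeleton K (int n - 1) \<and>
        orientation K s \<in> carrier G \<and> generate G {orientation K s} = carrier G)"


section \<open>Cellular chains and homology\<close>

definition skeletal_homology :: "'a cw_complex \<Rightarrow> int \<Rightarrow> 'a chain set monoid" where
  "skeletal_homology K m =
     relative_homology_group m (subtopology (space K) (skeleton K m)) (skeleton K (m - 1))"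

text \<open>The class in \<open>H\<^sub>n(X\<^sup>n, X\<^sup>n\<^sup>-\<^sup>1)\<close> of an oriented \<open>n\<close>-cell.\<close>

definition cell_class :: "'a cw_complex \<Rightarrow> 'a set \<Rightarrow> 'a chain set" where
  "cell_class K s = (let n = cell_dim K s in
     hom_induced (int n) (std_disc n) (std_sphere n)
       (subtopology (space K) (skeleton K (int n))) (skeleton K (int n - 1))
       (char_map K s) (orientation K s))"

text \<open>The integral cellular boundary: \<open>hom_relboundary\<close> is the connecting homomorphism
  \<open>H\<^sub>n(X\<^sup>n, X\<^sup>n\<^sup>-\<^sup>1) \<rightarrow> H\<^sub>n\<^sub>-\<^sub>1(X\<^sup>n\<^sup>-\<^sup>1)\<close> followed by
  \<open>H\<^sub>n\<^sub>-\<^sub>1(X\<^sup>n\<^sup>-\<^sup>1) \<rightarrow> H\<^sub>n\<^sub>-\<^sub>1(X\<^sup>n\<^sup>-\<^sup>1, X\<^sup>n\<^sup>-\<^sup>2)\<close>.\<close>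

definition cell_boundary_class :: "'a cw_complex \<Rightarrow> 'a set \<Rightarrow> 'a chain set" where
  "cell_boundary_class K s = (let n = int (cell_dim K s) in
     hom_relboundary n (subtopology (space K) (skeleton K n))
       (skeleton K (n - 1)) (skeleton K (n - 2)) (cell_class K s))"

text \<open>\<open>incidence K s t\<close> is the integer \<open>[s : t]\<close>: the family \<open>[s : \<cdot>]\<close> consists of the coordinates
  of the boundary of \<open>s\<close> in the basis of \<open>H\<^sub>n\<^sub>-\<^sub>1(X\<^sup>n\<^sup>-\<^sup>1, X\<^sup>n\<^sup>-\<^sup>2)\<close> given by the oriented
  \<open>(n-1)\<close>-cells (homology groups are written multiplicatively in the library), and is zero
  outside these cells.\<close>

definition incidence :: "'a cw_complex \<Rightarrow> 'a set \<Rightarrow> 'a set \<Rightarrow> int" where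
  "incidence K s = (let F = {t \<in> cells K. Suc (cell_dim K t) = cell_dim K s};
                        G = skeletal_homology K (int (cell_dim K s) - 1) in
     (THE a. (\<forall>t. t \<notin> F \<longrightarrow> a t = 0) \<and>
             cell_boundary_class K s = finprod G (\<lambda>t. cell_class K t [^]\<^bsub>G\<^esub> (a t :: int)) F))"

text \<open>A cellular \<open>q\<close>-chain with coefficients in a field is the family of its coefficients.
  For a set \<open>S\<close> of cells forming a subcomplex \<open>L\<close>, \<open>cellular_chains K S q\<close> is \<open>C\<^sub>q(L)\<close>,
  viewed inside \<open>C\<^sub>q(K)\<close>.  The multiplicative part of the \<open>module\<close> record is irrelevant.\<close>

definition cellular_chains ::
    "'a cw_complex \<Rightarrow> 'a set set \<Rightarrow> nat \<Rightarrow> ('k::field, 'a set \<Rightarrow> 'k) module" where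
  "cellular_chains K S q =
     \<lparr> carrier = {c. \<forall>s. c s \<noteq> 0 \<longrightarrow> s \<in> S \<and> cell_dim K s = q},
       mult = undefined, one = undefined,
       zero = (\<lambda>s. 0), add = (\<lambda>c d s. c s + d s), smult = (\<lambda>a c s. a * c s) \<rparr>"

definition cellular_boundary ::
    "'a cw_complex \<Rightarrow> nat \<Rightarrow> ('a set \<Rightarrow> 'k::field) \<Rightarrow> 'a set \<Rightarrow> 'k" where
  "cellular_boundary K q c =
     (\<lambda>t. \<Sum>s \<in> {s \<in> cells K. cell_dim K s = q}. c s * of_int (incidence K s t))"

definition cellular_cycles ::
    "'a cw_complex \<Rightarrow> 'a set set \<Rightarrow> nat \<Rightarrow> ('k::field, 'a set \<Rightarrow> 'k) module" where
  "cellular_cycles K S q = (cellular_chains K S q)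
     \<lparr> carrier := {c \<in> carrier (cellular_chains K S q). cellular_boundary K q c = (\<lambda>t. 0)} \<rparr>"

definition cellular_boundaries ::
    "'a cw_complex \<Rightarrow> 'a set set \<Rightarrow> nat \<Rightarrow> ('a set \<Rightarrow> 'k::field) set" where
  "cellular_boundaries K S q =
     cellular_boundary K (Suc q) ` carrier (cellular_chains K S (Suc q))"

definition quotient_module :: "('k, 'v) module \<Rightarrow> 'v set \<Rightarrow> ('k, 'v set) module" where
  "quotient_module M B =
     \<lparr> carrier = a_rcosets\<^bsub>M\<^esub> B,
       mult = undefined, one = undefined,
       zero = B, add = set_add M,
       smult = (\<lambda>a C. \<Union>c\<in>C. B +>\<^bsub>M\<^esub> (a \<odot>\<^bsub>M\<^esub> c)) \<rparr>"

definition cellular_homology ::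
    "'a cw_complex \<Rightarrow> 'a set set \<Rightarrow> nat \<Rightarrow> ('k::field, ('a set \<Rightarrow> 'k) set) module" where
  "cellular_homology K S q = quotient_module (cellular_cycles K S q) (cellular_boundaries K S q)"

definition homology_class ::
    "'a cw_complex \<Rightarrow> 'a set set \<Rightarrow> nat \<Rightarrow> ('a set \<Rightarrow> 'k::field) \<Rightarrow> ('a set \<Rightarrow> 'k) set" where
  "homology_class K S q z = cellular_boundaries K S q +>\<^bsub>cellular_cycles K S q\<^esub> z"


section \<open>Filtrations and matrix reduction\<close>

definition filtration_function :: "'a cw_complex \<Rightarrow> ('a set \<Rightarrow> real) \<Rightarrow> bool" where
  "filtration_function K f \<longleftrightarrow>
     (\<forall>s \<in> cells K. \<forall>t \<in> cells K. t \<subseteq> space K closure_of s \<longrightarrow> f t \<le> f s)"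

text \<open>The cells are enumerated as \<open>\<sigma> 1, \<dots>, \<sigma> N\<close>.\<close>

definition compatible_order ::
    "'a cw_complex \<Rightarrow> ('a set \<Rightarrow> real) \<Rightarrow> nat \<Rightarrow> (nat \<Rightarrow> 'a set) \<Rightarrow> bool" where
  "compatible_order K f N \<sigma> \<longleftrightarrow>
     bij_betw \<sigma> {1..N} (cells K) \<and>
     (\<forall>i \<in> {1..N}. \<forall>j \<in> {1..N}.
        (f (\<sigma> i) < f (\<sigma> j) \<longrightarrow> i < j) \<and>
        (\<sigma> i \<subseteq> space K closure_of (\<sigma> j) \<and> \<sigma> i \<noteq> \<sigma> j \<longrightarrow> i < j))"

definition stage_cells :: "(nat \<Rightarrow> 'a set) \<Rightarrow> nat \<Rightarrow> 'a set set" where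
  "stage_cells \<sigma> p = \<sigma> ` {1..p}"

text \<open>An \<open>N \<times> N\<close> matrix is a function of row and column index, of which only the entries with
  indices in \<open>{1..N}\<close> matter.\<close>

definition boundary_matrix ::
    "'a cw_complex \<Rightarrow> (nat \<Rightarrow> 'a set) \<Rightarrow> nat \<Rightarrow> nat \<Rightarrow> 'k::field" where
  "boundary_matrix K \<sigma> i j = of_int (incidence K (\<sigma> j) (\<sigma> i))"

definition zero_column :: "nat \<Rightarrow> (nat \<Rightarrow> nat \<Rightarrow> 'k::zero) \<Rightarrow> nat \<Rightarrow> bool" where
  "zero_column N M j \<longleftrightarrow> (\<forall>i \<in> {1..N}. M i j = 0)"

definition low :: "nat \<Rightarrow> (nat \<Rightarrow> nat \<Rightarrow> 'k::zero) \<Rightarrow> nat \<Rightarrow> nat" where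
  "low N M j = Max {i \<in> {1..N}. M i j \<noteq> 0}"

definition reduced :: "nat \<Rightarrow> (nat \<Rightarrow> nat \<Rightarrow> 'k::zero) \<Rightarrow> bool" where
  "reduced N M \<longleftrightarrow>
     (\<forall>j \<in> {1..N}. \<forall>j' \<in> {1..N}. j \<noteq> j' \<and> \<not> zero_column N M j \<and> \<not> zero_column N M j'
        \<longrightarrow> low N M j \<noteq> low N M j')"

definition upper_unitriangular :: "nat \<Rightarrow> (nat \<Rightarrow> nat \<Rightarrow> 'k::zero_neq_one) \<Rightarrow> bool" where
  "upper_unitriangular N M \<longleftrightarrow>
     (\<forall>i \<in> {1..N}. M i i = 1) \<and> (\<forall>i \<in> {1..N}. \<forall>j \<in> {1..N}. j < i \<longrightarrow> M i j = 0)"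

definition dimension_preserving ::
    "'a cw_complex \<Rightarrow> nat \<Rightarrow> (nat \<Rightarrow> 'a set) \<Rightarrow> (nat \<Rightarrow> nat \<Rightarrow> 'k::zero) \<Rightarrow> bool" where
  "dimension_preserving K N \<sigma> M \<longleftrightarrow>
     (\<forall>l \<in> {1..N}. \<forall>i \<in> {1..N}. M l i \<noteq> 0 \<longrightarrow> cell_dim K (\<sigma> l) = cell_dim K (\<sigma> i))"

definition reduction ::
    "'a cw_complex \<Rightarrow> nat \<Rightarrow> (nat \<Rightarrow> 'a set) \<Rightarrow> (nat \<Rightarrow> nat \<Rightarrow> 'k::field) \<Rightarrow> (nat \<Rightarrow> nat \<Rightarrow> 'k) \<Rightarrow> bool"
  where
  "reduction K N \<sigma> R V \<longleftrightarrow>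
     (\<forall>i \<in> {1..N}. \<forall>j \<in> {1..N}. R i j = (\<Sum>l = 1..N. boundary_matrix K \<sigma> i l * V l j)) \<and>
     reduced N R \<and> upper_unitriangular N V \<and> dimension_preserving K N \<sigma> V"

definition birth_cycle ::
    "'a cw_complex \<Rightarrow> (nat \<Rightarrow> 'a set) \<Rightarrow> (nat \<Rightarrow> nat \<Rightarrow> 'k::field) \<Rightarrow> nat \<Rightarrow> 'a set \<Rightarrow> 'k" where
  "birth_cycle K \<sigma> V i =
     (\<lambda>s. \<Sum>l \<in> {l \<in> {1..i}. cell_dim K (\<sigma> l) = cell_dim K (\<sigma> i)}. if s = \<sigma> l then V l i else 0)"

definition pair :: "nat \<Rightarrow> (nat \<Rightarrow> nat \<Rightarrow> 'k::zero) \<Rightarrow> nat \<Rightarrow> enat" where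
  "pair N R i =
     (if \<exists>j \<in> {1..N}. \<not> zero_column N R j \<and> low N R j = i
      then enat (THE j. j \<in> {1..N} \<and> \<not> zero_column N R j \<and> low N R j = i)
      else \<infinity>)"

definition active_set ::
    "'a cw_complex \<Rightarrow> nat \<Rightarrow> (nat \<Rightarrow> 'a set) \<Rightarrow> (nat \<Rightarrow> nat \<Rightarrow> 'k::zero) \<Rightarrow> nat \<Rightarrow> nat \<Rightarrow> nat set" where
  "active_set K N \<sigma> R q p =
     {i \<in> {1..N}. cell_dim K (\<sigma> i) = q \<and> zero_column N R i \<and> i \<le> p \<and> enat p < pair N R i}"

end

theory Submission
  imports Defs
begin

text \<open>Two topological facts make the incidence numbers behave as they should, and both come
  from the local projections \<open>H\<^sub>n(X\<^sup>n, X\<^sup>n\<^sup>-\<^sup>1) \<rightarrow> H\<^sub>n(X\<^sup>n, X\<^sup>n - t)\<close> onto an infinite cyclic group,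
  one for each \<open>n\<close>-cell \<open>t\<close>.  The projection belonging to \<open>t\<close> sends the class of \<open>t\<close> to a generator and the
  class of every other \<open>n\<close>-cell to \<open>0\<close>; so the cell classes are independent, and attaching the cells
  one at a time shows that they generate.  Hence the incidence numbers are the coordinates of the
  cellular boundary, and \<open>D\<^sup>2 = 0\<close>.  If some point
  \<open>c\<close> of \<open>t\<close> lies outside the closure of \<open>s\<close>, then the boundary of \<open>s\<close> dies in
  \<open>H\<^sub>n(X\<^sup>n, X\<^sup>n - {c})\<close>, which is isomorphic to \<open>H\<^sub>n(X\<^sup>n, X\<^sup>n - t)\<close>, so \<open>[s : t] = 0\<close>;
  hence \<open>D\<close> is strictly upper triangular.

  The rest is elimination on the largest index in the support.  If the largest index \<open>m\<close>
  of a cycle belonged to a nonzero column, a nontrivial combination of nonzero columns of \<open>R\<close> would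
  vanish, although their lows are distinct; so \<open>m\<close> is positive, and it can be removed by subtracting
  a multiple of \<open>z\<^sub>m\<close> if \<open>m\<close> is active, and of the boundary \<open>R\<^sub>j\<close> with \<open>j = pair m\<close>
  otherwise.  Conversely, the largest index of a nonzero boundary in \<open>K\<^sup>p\<close> is the low of some \<open>R\<^sub>j\<close>
  with \<open>j \<le> p\<close>, and such an index is not active.\<close>


section \<open>Discs and punctured discs\<close>

lemma topspace_std_disc: "topspace (std_disc n) = {x. (\<forall>i\<ge>n. x i = 0) \<and> (\<Sum>i<n. (x i)\<^sup>2) \<le> 1}"
  by (auto simp: std_disc_def topspace_Euclidean_space)

text \<open>The function type \<open>nat \<Rightarrow> real\<close> carries the product topology, so
  the type-class notions \<open>closed\<close>, \<open>compact\<close> and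
  \<open>continuous_on\<close> become available for the disc.\<close>

lemma std_disc_eq_top_of_set: "std_disc n = top_of_set (topspace (std_disc n))"
proof -
  have "std_disc n = top_of_set ({x. \<forall>i\<ge>n. x i = 0} \<inter> {x. (\<Sum>i<n. (x i)\<^sup>2) \<le> 1})"
    by (simp add: std_disc_def Euclidean_space_def euclidean_product_topology subtopology_subtopology)
  then show ?thesis
    by simp
qed

lemma std_open_disc_Un_sphere: "std_open_disc n \<union> std_sphere n = topspace (std_disc n)"
  by (auto simp: std_open_disc_def std_sphere_def topspace_std_disc)

lemma std_open_disc_Int_sphere: "std_open_disc n \<inter> std_sphere n = {}"
  by (auto simp: std_open_disc_def std_sphere_def)

lemma std_open_disc_subset: "std_open_disc n \<subseteq> topspace (std_disc n)"
  and std_sphere_subset: "std_sphere n \<subseteq> topspace (std_disc n)"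
  by (auto simp: std_open_disc_def std_sphere_def)

lemma Hausdorff_space_std_disc: "Hausdorff_space (std_disc n)"
  by (simp add: std_disc_def Hausdorff_Euclidean_space Hausdorff_space_subtopology)

lemma closed_std_disc: "closed (topspace (std_disc n))"
proof -
  have "topspace (std_disc n) = (\<Inter>i\<in>{n..}. {x. x i = 0}) \<inter> {x. (\<Sum>i<n. (x i)\<^sup>2) \<le> 1}"
    by (auto simp: topspace_std_disc)
  moreover have "closed {x::nat \<Rightarrow> real. x i = 0}" for i
    by (intro closed_Collect_eq continuous_intros continuous_on_product_coordinates)
  moreover have "closed {x::nat \<Rightarrow> real. (\<Sum>i<n. (x i)\<^sup>2) \<le> 1}"
    by (intro closed_Collect_le continuous_intros continuous_on_product_coordinates)
  ultimately show ?thesis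
    by (metis (mono_tags, lifting) closed_INT closed_Int)
qed

text \<open>Being closed, the disc inherits compactness from the infinite cube with sides
  \<open>{-1..1}\<close>, which is compact by Tychonoff.\<close>

lemma compact_space_std_disc: "compact_space (std_disc n)"
proof -
  have "compactin (powertop_real UNIV) (PiE UNIV (\<lambda>i. {-1..1}))"
    by (simp add: compactin_PiE compactin_euclidean_iff)
  then have "compact (PiE UNIV (\<lambda>i::nat. {-1..1::real}))"
    by (simp add: euclidean_product_topology compactin_euclidean_iff)
  moreover have "topspace (std_disc n) \<subseteq> PiE UNIV (\<lambda>i. {-1..1})"
  proof
    fix x assume x: "x \<in> topspace (std_disc n)"
    have "(x i)\<^sup>2 \<le> 1" for i
    proof (cases "i < n")
      case True
      then have "(x i)\<^sup>2 \<le> (\<Sum>i<n. (x i)\<^sup>2)"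
        by (intro member_le_sum) auto
      then show ?thesis
        using x by (simp add: topspace_std_disc)
    next
      case False
      then show ?thesis
        using x by (simp add: topspace_std_disc)
    qed
    then show "x \<in> PiE UNIV (\<lambda>i. {-1..1})"
      by (simp add: PiE_iff abs_square_le_1 abs_le_iff minus_le_iff)
  qed
  ultimately have "compact (topspace (std_disc n))"
    using closed_std_disc compact_Int_closed by (metis inf.absorb_iff2)
  then show ?thesis
    by (metis std_disc_eq_top_of_set compact_space_subtopology compactin_euclidean_iff)
qed

lemma closedin_std_sphere: "closedin (std_disc n) (std_sphere n)"
proof -
  have "std_sphere n = topspace (std_disc n) \<inter> {x. (\<Sum>i<n. (x i)\<^sup>2) = 1}"
    by (auto simp: std_sphere_def)
  moreover have "closed {x::nat \<Rightarrow> real. (\<Sum>i<n. (x i)\<^sup>2) = 1}"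
    by (intro closed_Collect_eq continuous_intros continuous_on_product_coordinates)
  ultimately show ?thesis
    by (metis std_disc_eq_top_of_set closedin_closed_Int)
qed

lemma std_disc_convex:
  assumes "x \<in> topspace (std_disc n)" "y \<in> topspace (std_disc n)" "0 \<le> t" "t \<le> 1"
  shows "(\<lambda>i. (1 - t) * x i + t * y i) \<in> topspace (std_disc n)"
proof -
  \<comment> \<open>Convexity of the square: the gap between the two sides is
    \<open>t * (1 - t) * (a - b)\<^sup>2\<close>.\<close>
  have *: "((1 - t) * a + t * b)\<^sup>2 \<le> (1 - t) * a\<^sup>2 + t * b\<^sup>2" for a b :: real
  proof -
    have "(1 - t) * a\<^sup>2 + t * b\<^sup>2 - ((1 - t) * a + t * b)\<^sup>2 = t * (1 - t) * (a - b)\<^sup>2"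
      by (simp add: power2_eq_square algebra_simps)
    also have "\<dots> \<ge> 0"
      using assms by simp
    finally show ?thesis
      by simp
  qed
  have "(\<Sum>i<n. ((1 - t) * x i + t * y i)\<^sup>2) \<le> (\<Sum>i<n. (1 - t) * (x i)\<^sup>2 + t * (y i)\<^sup>2)"
    by (intro sum_mono *)
  also have "\<dots> = (1 - t) * (\<Sum>i<n. (x i)\<^sup>2) + t * (\<Sum>i<n. (y i)\<^sup>2)"
    by (simp add: sum.distrib sum_distrib_left)
  also have "\<dots> \<le> (1 - t) * 1 + t * 1"
    using assms by (intro add_mono mult_left_mono) (auto simp: topspace_std_disc)
  finally show ?thesis
    using assms by (simp add: topspace_std_disc)
qed

text \<open>Radial projection away from \<open>d\<close>. Any interior point is allowed as
  \<open>d\<close>, since a cell will later be punctured at a prescribed point; the last property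
  makes the projection a deformation retraction of the punctured disc.\<close>

lemma std_disc_radial_retraction:
  assumes d: "d \<in> std_open_disc n"
  obtains \<rho> where "continuous_on (topspace (std_disc n) - {d}) \<rho>"
    and "\<And>y. y \<in> topspace (std_disc n) - {d} \<Longrightarrow> \<rho> y \<in> std_sphere n"
    and "\<And>y. y \<in> std_sphere n \<Longrightarrow> \<rho> y = y"
    and "\<And>y t. \<lbrakk>y \<in> topspace (std_disc n) - {d}; 0 \<le> t; t \<le> 1\<rbrakk>
           \<Longrightarrow> (\<lambda>i. (1 - t) * y i + t * \<rho> y i) \<in> topspace (std_disc n) - {d}"
proof -
  txt \<open>The ray from \<open>d\<close> through \<open>y\<close> leaves the disc at \<open>d + s (y - d)\<close>, where \<open>s\<close> is the positive
    root of \<open>|d + s (y - d)|\<^sup>2 = 1\<close>.\<close>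
  define a where "a = (\<lambda>y. \<Sum>i<n. (y i - d i)\<^sup>2)"
  define b where "b = (\<lambda>y. \<Sum>i<n. d i * (y i - d i))"
  define c where "c = 1 - (\<Sum>i<n. (d i)\<^sup>2)"
  define s where "s = (\<lambda>y. (- b y + sqrt ((b y)\<^sup>2 + a y * c)) / a y)"
  define \<rho> where "\<rho> = (\<lambda>y i. d i + s y * (y i - d i))"
  have c: "c > 0"
    using d by (simp add: c_def std_open_disc_def)
  have d0: "d i = 0" if "i \<ge> n" for i
    using d that by (simp add: std_open_disc_def topspace_std_disc)
  have a: "a y > 0" if y: "y \<in> topspace (std_disc n) - {d}" for y
  proof -
    obtain i where "y i \<noteq> d i"
      using y by blast
    moreover from this have "i < n"
      using d0 y by (force simp: topspace_std_disc not_less)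
    ultimately show ?thesis
      unfolding a_def by (intro sum_pos2[where i = i]) auto
  qed
  \<comment> \<open>The squared norm along the ray is a quadratic in \<open>r\<close>; its constant
    term \<open>1 - c\<close> is the squared norm of \<open>d\<close>.\<close>
  have quadratic: "(\<Sum>i<n. (d i + r * (y i - d i))\<^sup>2) = 1 - c + 2 * r * b y + r\<^sup>2 * a y" for r y
  proof -
    have "(\<Sum>i<n. (d i + r * (y i - d i))\<^sup>2)
        = (\<Sum>i<n. (d i)\<^sup>2 + (2 * r) * (d i * (y i - d i)) + r\<^sup>2 * (y i - d i)\<^sup>2)"
      by (intro sum.cong refl) (simp add: power2_eq_square algebra_simps)
    then show ?thesis
      by (simp add: sum.distrib sum_distrib_left a_def b_def c_def)
  qed
  have s: "s y > 0" if y: "y \<in> topspace (std_disc n) - {d}" for y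
  proof -
    have "\<bar>b y\<bar> < sqrt ((b y)\<^sup>2 + a y * c)"
      using a[OF y] c by (intro real_less_rsqrt) simp
    then show ?thesis
      using a[OF y] by (simp add: s_def)
  qed
  have root: "1 - c + 2 * s y * b y + (s y)\<^sup>2 * a y = 1" if y: "y \<in> topspace (std_disc n) - {d}" for y
  proof -
    have "(a y * s y + b y)\<^sup>2 = (b y)\<^sup>2 + a y * c"
      using a[OF y] c by (simp add: s_def)
    then have "a y * (2 * s y * b y + (s y)\<^sup>2 * a y - c) = 0"
      by (simp add: power2_eq_square algebra_simps)
    then show ?thesis
      using a[OF y] by simp
  qed
  have sphere: "\<rho> y \<in> std_sphere n" if "y \<in> topspace (std_disc n) - {d}" for y
    using root[OF that] quadratic[of "s y" y] d0 that
    by (auto simp: std_sphere_def topspace_std_disc \<rho>_def)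
  show ?thesis
  proof
    have "continuous_on (topspace (std_disc n) - {d}) a"
      "continuous_on (topspace (std_disc n) - {d}) b"
      unfolding a_def b_def
      by (intro continuous_intros continuous_on_subset[OF continuous_on_product_coordinates] subset_UNIV)+
    moreover have "\<forall>y \<in> topspace (std_disc n) - {d}. a y \<noteq> 0"
      using a by (metis less_irrefl)
    ultimately have "continuous_on (topspace (std_disc n) - {d}) s"
      unfolding s_def by (intro continuous_intros)
    then show "continuous_on (topspace (std_disc n) - {d}) \<rho>"
      unfolding \<rho>_def
      by (intro continuous_intros continuous_on_subset[OF continuous_on_product_coordinates] subset_UNIV)
    show "\<rho> y \<in> std_sphere n" if "y \<in> topspace (std_disc n) - {d}" for y
      using sphere that .
    show "\<rho> y = y" if y: "y \<in> std_sphere n" for y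
    proof -
      have y': "y \<in> topspace (std_disc n) - {d}"
        using y d by (auto simp: std_sphere_def std_open_disc_def)
      have "(\<Sum>i<n. (y i)\<^sup>2) = 1"
        using y by (simp add: std_sphere_def)
      \<comment> \<open>For \<open>y\<close> on the sphere, \<open>r = 1\<close> solves the
        equation. This turns the radicand into the square of \<open>a y + b y\<close>, which is half
        of \<open>a y + c\<close> and hence positive.\<close>
      then have eq: "c = 2 * b y + a y"
        using quadratic[of 1 y] by simp
      have "(b y)\<^sup>2 + a y * c = (a y + b y)\<^sup>2"
        by (simp add: eq power2_eq_square algebra_simps)
      moreover have "a y + b y \<ge> 0"
        using eq c a[OF y'] by simp
      ultimately have "s y = 1"
        using a[OF y'] by (simp add: s_def)
      then show ?thesis
        by (simp add: \<rho>_def)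
    qed
    show "(\<lambda>i. (1 - t) * y i + t * \<rho> y i) \<in> topspace (std_disc n) - {d}"
      if y: "y \<in> topspace (std_disc n) - {d}" and t: "0 \<le> t" "t \<le> 1" for y t
    proof -
      have "(\<lambda>i. (1 - t) * y i + t * \<rho> y i) \<noteq> d"
      proof
        assume eq: "(\<lambda>i. (1 - t) * y i + t * \<rho> y i) = d"
        \<comment> \<open>The displacement of the moving point from \<open>d\<close> is a positive
          multiple of \<open>y - d\<close>, so the point never meets \<open>d\<close>.\<close>
        have "((1 - t) + t * s y) * (y i - d i) = 0" for i
          using fun_cong[OF eq, of i] by (simp add: \<rho>_def algebra_simps)
        moreover have "(1 - t) + t * s y > 0"
          using t s[OF y] by (cases "t = 1") (auto intro: add_pos_nonneg)
        ultimately have "y = d"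
          by (metis eq_iff_diff_eq_0 ext less_irrefl mult_eq_0_iff)
        then show False
          using y by simp
      qed
      then show ?thesis
        using std_disc_convex[of y n "\<rho> y" t] y t sphere[OF y] std_sphere_subset by blast
    qed
  qed
qed


section \<open>Attaching a single cell\<close>

text \<open>In the long exact sequence of the triple \<open>T \<subseteq> S \<subseteq> X\<close>,
  the groups of \<open>(S, T)\<close> on either side of this map vanish.\<close>

lemma trivial_relative_homology_imp_iso:
  assumes "\<And>p. trivial_group (relative_homology_group p (subtopology X S) T)" "T \<subseteq> S"
  shows "hom_induced p X T X S id \<in> iso (relative_homology_group p X T) (relative_homology_group p X S)"
proof (rule very_short_exact_sequence)
  show "exact_seq
         ([relative_homology_group (p - 1) (subtopology X S) T, relative_homology_group p X S,
           relative_homology_group p X T, relative_homology_group p (subtopology X S) T],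
          [hom_relboundary p X S T, hom_induced p X T X S id, hom_induced p (subtopology X S) T X T id])"
    using homology_exactness_triple_1[OF \<open>T \<subseteq> S\<close>, of p X] homology_exactness_triple_3[OF \<open>T \<subseteq> S\<close>, of p X]
    unfolding exact_seq_cons_iff exact_seq_end_iff by blast
qed (use assms in auto)

text \<open>Only bijectivity on the open disc is assumed; compactness of the closed disc upgrades it
  to a homeomorphism in \<open>homeomorphic_char_map\<close>.\<close>

locale cell_attachment =
  fixes X :: "'a topology" and A :: "'a set" and n :: nat and \<Phi> :: "(nat \<Rightarrow> real) \<Rightarrow> 'a"
  assumes Hausdorff: "Hausdorff_space X"
    and closedin_A: "closedin X A"
    and continuous_char_map: "continuous_map (std_disc n) X \<Phi>"
    and char_map_sphere: "\<Phi> ` std_sphere n \<subseteq> A"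
    and bij_char_map: "bij_betw \<Phi> (std_open_disc n) (topspace X - A)"
begin

lemma closed_char_map: "closed_map (std_disc n) X \<Phi>"
  using continuous_char_map compact_space_std_disc Hausdorff by (rule continuous_imp_closed_map)

lemma char_map_in_A_iff: "y \<in> topspace (std_disc n) \<Longrightarrow> \<Phi> y \<in> A \<longleftrightarrow> y \<in> std_sphere n"
  using bij_char_map char_map_sphere std_open_disc_Un_sphere[of n]
  unfolding bij_betw_def by blast

lemma char_map_eq_iff:
  assumes "d \<in> std_open_disc n" "y \<in> topspace (std_disc n)"
  shows "\<Phi> y = \<Phi> d \<longleftrightarrow> y = d"
proof
  assume eq: "\<Phi> y = \<Phi> d"
  have "\<Phi> d \<notin> A"
    using assms bij_char_map unfolding bij_betw_def by blast
  then have "y \<in> std_open_disc n"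
    using eq assms char_map_in_A_iff std_open_disc_Un_sphere by force
  then show "y = d"
    using bij_char_map assms eq unfolding bij_betw_def inj_on_def by blast
qed simp

text \<open>The radial deformation of the punctured disc is transported along \<Phi> and extended by
  the identity on \<open>A\<close>; it pushes the punctured space into \<open>A\<close> while fixing
  \<open>A\<close> pointwise.\<close>

lemma trivial_homology_punctured:
  assumes d: "d \<in> std_open_disc n"
  shows "trivial_group (relative_homology_group p (subtopology X (topspace X - {\<Phi> d})) A)"
proof -
  define Y where "Y = subtopology X (topspace X - {\<Phi> d})"
  define B :: "(nat \<Rightarrow> real) set" where "B = topspace (std_disc n) - {d}"
  define J where "J = top_of_set {0..1::real}"
  obtain \<rho> where \<rho>: "continuous_on B \<rho>" "\<And>y. y \<in> B \<Longrightarrow> \<rho> y \<in> std_sphere n"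
    "\<And>y. y \<in> std_sphere n \<Longrightarrow> \<rho> y = y"
    "\<And>y t. \<lbrakk>y \<in> B; 0 \<le> t; t \<le> 1\<rbrakk> \<Longrightarrow> (\<lambda>i. (1 - t) * y i + t * \<rho> y i) \<in> B"
    by (rule std_disc_radial_retraction[OF d, folded B_def]) (rule that)
  \<comment> \<open>Straight-line homotopy from the identity to the retraction \<rho>.\<close>
  define L where "L = (\<lambda>(t, y) i. (1 - t) * y i + t * \<rho> y i)"
  define g where "g = (\<lambda>(t, x). if x \<in> A then x else \<Phi> (L (t, inv_into (std_open_disc n) \<Phi> x)))"
  have \<Phi>d: "\<Phi> d \<notin> A" "\<Phi> d \<in> topspace X"
    using d bij_char_map unfolding bij_betw_def by blast+
  have AY: "A \<subseteq> topspace Y"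
    using \<Phi>d closedin_subset[OF closedin_A] by (auto simp: Y_def)
  have \<Phi>B: "\<Phi> y \<in> topspace Y" if "y \<in> B" for y
    using that char_map_eq_iff[OF d] continuous_map_image_subset_topspace[OF continuous_char_map]
    by (auto simp: Y_def B_def)
  \<comment> \<open>On the sphere \<open>L\<close> is stationary, so the two clauses of
    \<open>g\<close> fit together and \<open>g\<close> is \<open>L\<close> seen through
    \<Phi>.\<close>
  have gL: "g (t, \<Phi> y) = \<Phi> (L (t, y))" if y: "y \<in> B" for t y
  proof (cases "y \<in> std_sphere n")
    case True
    then have "L (t, y) = y"
      using \<rho>(3) by (auto simp: L_def algebra_simps)
    moreover have "\<Phi> y \<in> A"
      using True char_map_sphere by blast
    ultimately show ?thesis
      by (simp add: g_def)
  next
    case False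
    then have "\<Phi> y \<notin> A" "y \<in> std_open_disc n"
      using y char_map_in_A_iff std_open_disc_Un_sphere by (auto simp: B_def)
    then show ?thesis
      using bij_char_map by (simp add: g_def bij_betw_def)
  qed
  have cover: "\<exists>y \<in> B. x = \<Phi> y" if x: "x \<in> topspace Y" "x \<notin> A" for x
  proof -
    have "x \<in> \<Phi> ` std_open_disc n"
      using x bij_char_map unfolding bij_betw_def Y_def by auto
    then show ?thesis
      using x std_open_disc_subset by (force simp: Y_def B_def)
  qed
  have gY: "g (t, x) \<in> topspace Y" if "0 \<le> t" "t \<le> 1" "x \<in> topspace Y" for t x
  proof (cases "x \<in> A")
    case False
    then obtain y where "y \<in> B" "x = \<Phi> y"
      using cover \<open>x \<in> topspace Y\<close> by blast
    then show ?thesis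
      using gL \<Phi>B \<rho>(4) that by (simp add: L_def)
  qed (use that in \<open>simp add: g_def\<close>)
  have cont_L: "continuous_map (prod_topology J (subtopology (std_disc n) B)) (subtopology (std_disc n) B) L"
  proof -
    have top: "subtopology (std_disc n) B = top_of_set B"
      using subtopology_subtopology[of euclidean "topspace (std_disc n)" B] std_disc_eq_top_of_set[of n]
      by (metis B_def Diff_subset inf.absorb2)
    have "continuous_on ({0..1} \<times> B) L"
      unfolding L_def case_prod_unfold
      by (intro continuous_on_coordinatewise_then_product continuous_intros
          continuous_on_product_then_coordinatewise[OF continuous_on_compose2[OF \<rho>(1) continuous_on_snd]]
          continuous_on_product_then_coordinatewise[OF continuous_on_snd]) auto
    moreover have "L ` ({0..1} \<times> B) \<subseteq> B"
      using \<rho>(4) by (auto simp: L_def)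
    ultimately show ?thesis
      by (simp add: top J_def euclidean_product_topology image_subset_iff_funcset)
  qed
  have cont_\<Phi>L: "continuous_map (prod_topology J (subtopology (std_disc n) B)) Y (\<lambda>w. \<Phi> (L w))"
  proof -
    have "continuous_map (subtopology (std_disc n) B) Y \<Phi>"
      using \<Phi>B continuous_char_map
      by (auto simp: Y_def continuous_map_in_subtopology continuous_map_from_subtopology)
    from continuous_map_compose[OF cont_L this] show ?thesis
      by (simp add: o_def)
  qed
  txt \<open>The homotopy \<open>g\<close> is continuous because it is so on \<open>A\<close> and after composition with the closed
    map \<open>\<Psi>\<close>.\<close>
  define \<Psi> where "\<Psi> = (\<lambda>(t::real, y). (t, \<Phi> y))"
  have closed_\<Psi>: "closed_map (prod_topology J (subtopology (std_disc n) B)) (prod_topology J Y) \<Psi>"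
  proof -
    \<comment> \<open>Closedness comes from compactness, which only the full disc offers; the
      puncture is made afterwards by restricting to a full preimage.\<close>
    have "continuous_map (prod_topology J (std_disc n)) (prod_topology J X) \<Psi>"
      using continuous_char_map
      by (auto simp: \<Psi>_def case_prod_unfold intro!: continuous_map_pairedI continuous_map_fst
          continuous_map_compose[OF continuous_map_snd, unfolded o_def])
    moreover have "compact_space (prod_topology J (std_disc n))"
      by (simp add: J_def compact_space_prod_topology compact_space_std_disc compact_space_subtopology)
    moreover have "Hausdorff_space (prod_topology J X)"
      by (simp add: J_def Hausdorff_space_prod_topology Hausdorff Hausdorff_space_subtopology)
    ultimately have "closed_map (prod_topology J (std_disc n)) (prod_topology J X) \<Psi>"
      by (rule continuous_imp_closed_map)
    moreover have "{w \<in> topspace (prod_topology J (std_disc n)). \<Psi> w \<in> UNIV \<times> (topspace X - {\<Phi> d})}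
        = {0..1} \<times> B"
      using char_map_eq_iff[OF d] continuous_map_image_subset_topspace[OF continuous_char_map]
      by (auto simp: \<Psi>_def B_def J_def)
    ultimately have "closed_map (subtopology (prod_topology J (std_disc n)) ({0..1} \<times> B))
            (subtopology (prod_topology J X) (UNIV \<times> (topspace X - {\<Phi> d}))) \<Psi>"
      by (rule closed_map_restriction)
    moreover have "subtopology J {0..1} = J"
      by (simp add: J_def subtopology_subtopology)
    ultimately show ?thesis
      by (simp add: subtopology_Times Y_def)
  qed
  have cont_g: "continuous_map (prod_topology J Y) Y g"
    unfolding continuous_map_closedin
  proof (intro conjI allI impI)
    show "g \<in> topspace (prod_topology J Y) \<rightarrow> topspace Y"
      using gY by (auto simp: J_def)
    fix C assume C: "closedin Y C"
    let ?P = "prod_topology J Y"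
    let ?Q = "prod_topology J (subtopology (std_disc n) B)"
    have "closedin Y (A \<inter> C)"
      using C closedin_A AY by (metis Y_def closedin_Int closedin_subset_topspace topspace_subtopology_subset Diff_subset)
    then have 1: "closedin ?P {z \<in> topspace ?P. snd z \<in> A \<inter> C}"
      by (rule closedin_continuous_map_preimage[OF continuous_map_snd])
    have "closedin ?Q {w \<in> topspace ?Q. \<Phi> (L w) \<in> C}"
      by (rule closedin_continuous_map_preimage[OF cont_\<Phi>L C])
    then have 2: "closedin ?P (\<Psi> ` {w \<in> topspace ?Q. \<Phi> (L w) \<in> C})"
      using closed_\<Psi> by (simp add: closed_map_def)
    have "{z \<in> topspace ?P. g z \<in> C} =
          {z \<in> topspace ?P. snd z \<in> A \<inter> C} \<union> \<Psi> ` {w \<in> topspace ?Q. \<Phi> (L w) \<in> C}"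
      (is "?lhs = ?rhs")
    proof (intro equalityI subsetI)
      fix z assume z: "z \<in> ?lhs"
      obtain t x where tx: "z = (t, x)"
        by fastforce
      show "z \<in> ?rhs"
      proof (cases "x \<in> A")
        case True
        then show ?thesis
          using z tx by (auto simp: g_def)
      next
        case False
        then obtain y where y: "y \<in> B" "x = \<Phi> y"
          using cover z tx by auto
        then have "(t, y) \<in> {w \<in> topspace ?Q. \<Phi> (L w) \<in> C}"
          using z tx gL by (auto simp: B_def)
        then show ?thesis
          using y tx by (force simp: \<Psi>_def)
      qed
    next
      fix z assume "z \<in> ?rhs"
      then show "z \<in> ?lhs"
      proof
        assume "z \<in> {z \<in> topspace ?P. snd z \<in> A \<inter> C}"
        then show ?thesis
          by (auto simp: g_def)
      next
        assume "z \<in> \<Psi> ` {w \<in> topspace ?Q. \<Phi> (L w) \<in> C}"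
        then show ?thesis
          using gL \<Phi>B by (auto simp: \<Psi>_def)
      qed
    qed
    then show "closedin ?P {z \<in> topspace ?P. g z \<in> C}"
      using closedin_Un[OF 1 2] by metis
  qed
  have g0: "g (0, x) = x" if "x \<in> topspace Y" for x
  proof (cases "x \<in> A")
    case False
    then obtain y where "y \<in> B" "x = \<Phi> y"
      using cover \<open>x \<in> topspace Y\<close> by blast
    then show ?thesis
      using gL[of y 0] by (simp add: L_def)
  qed (simp add: g_def)
  have g1: "g (1, x) \<in> A" if "x \<in> topspace Y" for x
  proof (cases "x \<in> A")
    case False
    then obtain y where "y \<in> B" "x = \<Phi> y"
      using cover \<open>x \<in> topspace Y\<close> by blast
    then show ?thesis
      using gL[of y 1] \<rho>(2) char_map_sphere by (auto simp: L_def)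
  qed (simp add: g_def)
  have "homotopic_with (\<lambda>k. k ` A \<subseteq> A) Y Y id (\<lambda>x. g (1, x))"
  proof (subst homotopic_with)
    show "h ` A \<subseteq> A \<longleftrightarrow> k ` A \<subseteq> A" if "\<And>x. x \<in> topspace Y \<Longrightarrow> h x = k x" for h k
      using that AY by (metis image_cong subsetD)
    show "\<exists>h. continuous_map (prod_topology (top_of_set {0..1::real}) Y) Y h \<and>
        (\<forall>x\<in>topspace Y. h (0, x) = id x) \<and> (\<forall>x\<in>topspace Y. h (1, x) = g (1, x)) \<and>
        (\<forall>t\<in>{0..1}. (\<lambda>x. h (t, x)) ` A \<subseteq> A)"
    proof (rule exI[where x = g], intro conjI ballI)
      show "continuous_map (prod_topology (top_of_set {0..1}) Y) Y g"
        using cont_g by (simp add: J_def)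
      show "(\<lambda>x. g (t, x)) ` A \<subseteq> A" for t
        by (auto simp: g_def)
    qed (use g0 in auto)
  qed
  moreover from this have "continuous_map Y (subtopology Y A) (\<lambda>x. g (1, x))"
    using g1 by (auto simp: continuous_map_in_subtopology dest!: homotopic_with_imp_continuous_maps)
  ultimately show ?thesis
    unfolding Y_def[symmetric]
    by (intro trivial_relative_homology_group_alt) (auto simp: homotopic_with_sym)
qed

lemma iso_homology_puncture:
  assumes "d \<in> std_open_disc n"
  shows "hom_induced p X A X (topspace X - {\<Phi> d}) id
      \<in> iso (relative_homology_group p X A) (relative_homology_group p X (topspace X - {\<Phi> d}))"
proof (rule trivial_relative_homology_imp_iso)
  show "A \<subseteq> topspace X - {\<Phi> d}"
    using closedin_subset[OF closedin_A] assms bij_char_map unfolding bij_betw_def by blast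
qed (rule trivial_homology_punctured[OF assms])

end

text \<open>The map factors through the homology of the pair \<open>(T, T)\<close>, which is
  trivial.\<close>

lemma hom_induced_into_subset:
  assumes f: "continuous_map X Y f" and S: "S \<subseteq> topspace X" and T: "f ` topspace X \<subseteq> T"
  shows "hom_induced p X S Y T f x = \<one>\<^bsub>relative_homology_group p Y T\<^esub>"
proof -
  let ?Z = "subtopology Y T"
  have "continuous_map X ?Z f"
    using f T by (simp add: continuous_map_in_subtopology image_subset_iff_funcset)
  then have "hom_induced p X S Y T f x
      = hom_induced p ?Z T Y T id (hom_induced p X S ?Z T f x)"
    using S T by (subst hom_induced_compose') (auto simp: continuous_map_from_subtopology)
  moreover have "trivial_group (relative_homology_group p ?Z T)"
    using trivial_relative_homology_group_topspace[of p ?Z]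
    by (metis inf.idem relative_homology_group_restrict topspace_subtopology inf_assoc)
  then have "hom_induced p X S ?Z T f x = \<one>\<^bsub>relative_homology_group p ?Z T\<^esub>"
    using hom_induced_carrier[of p X S ?Z T f x] by (auto simp: trivial_group_def)
  ultimately show ?thesis
    using hom_one[OF hom_induced_hom] by simp
qed

lemma iso_left_factor:
  assumes "h \<circ> f \<in> iso G K" "f \<in> iso G H" "h \<in> hom H K"
  shows "h \<in> iso H K"
proof -
  have "bij_betw f (carrier G) (carrier H)" "bij_betw (h \<circ> f) (carrier G) (carrier K)"
    using assms by (auto simp: iso_def)
  then show ?thesis
    using assms(3) bij_betw_comp_iff[of f "carrier G" "carrier H" h "carrier K"]
    by (simp add: iso_def)
qed

lemma iso_right_factor:
  assumes "h \<circ> f \<in> iso G K" "h \<in> iso H K" "f \<in> hom G H"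
  shows "f \<in> iso G H"
proof -
  have "bij_betw h (carrier H) (carrier K)" "bij_betw (h \<circ> f) (carrier G) (carrier K)"
    using assms by (auto simp: iso_def)
  moreover have "f ` carrier G \<subseteq> carrier H"
    using assms(3) by (auto simp: hom_def)
  ultimately show ?thesis
    using assms(3) bij_betw_comp_iff2[of h "carrier H" "carrier K" f "carrier G"]
    by (simp add: iso_def)
qed

lemma origin_in_std_open_disc: "(\<lambda>i. 0) \<in> std_open_disc n"
  by (simp add: std_open_disc_def topspace_std_disc)

text \<open>The model case: the disc arises from its sphere by attaching its interior, so the
  puncture and excision isomorphisms hold for the source of \<Phi> as well as for its
  target.\<close>

lemma cell_attachment_std_disc: "cell_attachment (std_disc n) (std_sphere n) n id"
proof
  have "topspace (std_disc n) - std_sphere n = std_open_disc n"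
    using std_open_disc_Un_sphere[of n] std_open_disc_Int_sphere[of n] by blast
  then show "bij_betw id (std_open_disc n) (topspace (std_disc n) - std_sphere n)"
    by simp
qed (use Hausdorff_space_std_disc closedin_std_sphere in auto)

context cell_attachment
begin

text \<open>Excision of \<open>A\<close> is allowed because \<open>A\<close> is closed and lies in
  the complement of a point, which is open in a Hausdorff space.\<close>

lemma iso_homology_excise:
  assumes d: "d \<in> std_open_disc n"
  shows "hom_induced p (subtopology X (topspace X - A)) (topspace X - {\<Phi> d} - A) X (topspace X - {\<Phi> d}) id
      \<in> iso (relative_homology_group p (subtopology X (topspace X - A)) (topspace X - {\<Phi> d} - A))
            (relative_homology_group p X (topspace X - {\<Phi> d}))"
proof -
  have "\<Phi> d \<in> topspace X - A"
    using d bij_char_map unfolding bij_betw_def by blast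
  moreover from this have "openin X (topspace X - {\<Phi> d})"
    using Hausdorff by (simp add: closedin_Hausdorff_sing_eq openin_diff)
  ultimately have "X closure_of A \<subseteq> X interior_of (topspace X - {\<Phi> d})"
    using closedin_A closedin_subset[OF closedin_A]
    by (auto simp: closure_of_closedin interior_of_openin)
  from homology_excision_axiom[OF this, of "topspace X" p] show ?thesis
    by simp
qed

text \<open>A continuous closed bijection; closedness survives the restriction because the open disc
  is the full preimage of the open cell.\<close>

lemma homeomorphic_char_map:
  "homeomorphic_map (subtopology (std_disc n) (std_open_disc n)) (subtopology X (topspace X - A)) \<Phi>"
proof (rule bijective_closed_imp_homeomorphic_map)
  have sub: "\<Phi> ` topspace (std_disc n) \<subseteq> topspace X"
    using continuous_map_image_subset_topspace[OF continuous_char_map] .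
  have im: "\<Phi> ` std_open_disc n = topspace X - A" and inj: "inj_on \<Phi> (std_open_disc n)"
    using bij_char_map by (auto simp: bij_betw_def)
  show "continuous_map (subtopology (std_disc n) (std_open_disc n)) (subtopology X (topspace X - A)) \<Phi>"
    using im continuous_char_map
    by (auto simp: continuous_map_in_subtopology continuous_map_from_subtopology)
  have "{y \<in> topspace (std_disc n). \<Phi> y \<in> topspace X - A} = std_open_disc n"
    using sub char_map_in_A_iff std_open_disc_Un_sphere[of n] std_open_disc_Int_sphere[of n]
    by blast
  then show "closed_map (subtopology (std_disc n) (std_open_disc n)) (subtopology X (topspace X - A)) \<Phi>"
    by (rule closed_map_restriction[OF closed_char_map])
  show "\<Phi> ` topspace (subtopology (std_disc n) (std_open_disc n)) = topspace (subtopology X (topspace X - A))"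
    using im std_open_disc_subset[of n] by (simp add: inf.absorb2)
  show "inj_on \<Phi> (topspace (subtopology (std_disc n) (std_open_disc n)))"
    using inj by (auto simp: inj_on_def)
qed

text \<open>Disc and target are compared along the same zigzag: enlarge the subspace to the
  complement of a point, then excise down to the open cell, where \<Phi> is a homeomorphism. Two
  commuting squares carry the isomorphism back to the original pairs.\<close>

lemma iso_homology_char_map:
  "hom_induced p (std_disc n) (std_sphere n) X A \<Phi>
   \<in> iso (relative_homology_group p (std_disc n) (std_sphere n)) (relative_homology_group p X A)"
proof -
  interpret disc: cell_attachment "std_disc n" "std_sphere n" n id
    by (rule cell_attachment_std_disc)
  define d :: "nat \<Rightarrow> real" where "d = (\<lambda>i. 0)"
  have d: "d \<in> std_open_disc n"
    by (simp add: d_def origin_in_std_open_disc)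
  define D where "D = std_disc n"
  define S where "S = std_sphere n"
  define D' where "D' = topspace D - {d}"
  define X' where "X' = topspace X - {\<Phi> d}"
  have DS: "topspace D - S = std_open_disc n"
    unfolding D_def S_def using std_open_disc_Un_sphere[of n] std_open_disc_Int_sphere[of n] by blast
  have cont: "continuous_map D X \<Phi>"
    by (simp add: D_def continuous_char_map)
  have \<Phi>D': "\<Phi> ` D' \<subseteq> X'"
    using continuous_map_image_subset_topspace[OF cont] char_map_eq_iff[OF d]
    by (auto simp: D_def D'_def X'_def)
  have \<Phi>open: "\<Phi> ` (topspace D - S) = topspace X - A" and inj: "inj_on \<Phi> (topspace D - S)"
    using bij_char_map by (auto simp: DS bij_betw_def)
  have \<Phi>D'S: "\<Phi> ` (D' - S) = X' - A"
  proof -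
    have "d \<in> topspace D - S"
      using d by (simp add: DS)
    then have "\<Phi> ` ((topspace D - S) - {d}) = (topspace X - A) - {\<Phi> d}"
      using inj \<Phi>open by (subst inj_on_image_set_diff[of \<Phi> "topspace D - S"]) auto
    moreover have "D' - S = (topspace D - S) - {d}" "X' - A = (topspace X - A) - {\<Phi> d}"
      by (auto simp: D'_def X'_def)
    ultimately show ?thesis
      by simp
  qed
  have D: "hom_induced p (subtopology D (topspace D - S)) (D' - S) D D' id
      \<in> iso (relative_homology_group p (subtopology D (topspace D - S)) (D' - S)) (relative_homology_group p D D')"
    "hom_induced p D S D D' id \<in> iso (relative_homology_group p D S) (relative_homology_group p D D')"
    using disc.iso_homology_excise[OF d, of p] disc.iso_homology_puncture[OF d, of p]
    unfolding D_def S_def D'_def by auto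
  have X: "hom_induced p (subtopology X (topspace X - A)) (X' - A) X X' id
      \<in> iso (relative_homology_group p (subtopology X (topspace X - A)) (X' - A)) (relative_homology_group p X X')"
    "hom_induced p X A X X' id \<in> iso (relative_homology_group p X A) (relative_homology_group p X X')"
    using iso_homology_excise[OF d, of p] iso_homology_puncture[OF d, of p]
    unfolding X'_def by auto
  have "homeomorphic_map (subtopology D (topspace D - S)) (subtopology X (topspace X - A)) \<Phi>"
    using homeomorphic_char_map by (simp add: DS) (simp add: D_def)
  then have "hom_induced p (subtopology D (topspace D - S)) (D' - S) (subtopology X (topspace X - A)) (X' - A) \<Phi>
      \<in> iso (relative_homology_group p (subtopology D (topspace D - S)) (D' - S))
            (relative_homology_group p (subtopology X (topspace X - A)) (X' - A))"
    using \<Phi>D'S by (intro homeomorphic_map_relative_homology_iso) (auto simp: D'_def)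
  from iso_set_trans[OF this X(1)]
  have "hom_induced p (subtopology X (topspace X - A)) (X' - A) X X' id \<circ>
      hom_induced p (subtopology D (topspace D - S)) (D' - S) (subtopology X (topspace X - A)) (X' - A) \<Phi>
      \<in> iso (relative_homology_group p (subtopology D (topspace D - S)) (D' - S)) (relative_homology_group p X X')"
    by (simp add: compose_def)
  \<comment> \<open>First square: \<Phi> commutes with excision. Three of its sides are
    isomorphisms, hence so is the fourth.\<close>
  also have "hom_induced p (subtopology X (topspace X - A)) (X' - A) X X' id \<circ>
      hom_induced p (subtopology D (topspace D - S)) (D' - S) (subtopology X (topspace X - A)) (X' - A) \<Phi>
    = hom_induced p D D' X X' \<Phi> \<circ> hom_induced p (subtopology D (topspace D - S)) (D' - S) D D' id"
    (is "?ex \<circ> ?h = ?k \<circ> ?ed")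
  proof -
    have "?ex \<circ> ?h = hom_induced p (subtopology D (topspace D - S)) (D' - S) X X' (id \<circ> \<Phi>)"
      using cont \<Phi>open \<Phi>D'S
      by (intro hom_induced_compose[symmetric])
        (auto simp: continuous_map_in_subtopology continuous_map_from_subtopology)
    moreover have "?k \<circ> ?ed = hom_induced p (subtopology D (topspace D - S)) (D' - S) X X' (\<Phi> \<circ> id)"
      using cont \<Phi>D'
      by (intro hom_induced_compose[symmetric]) (auto simp: continuous_map_from_subtopology)
    ultimately show ?thesis
      by simp
  qed
  finally have "hom_induced p D D' X X' \<Phi> \<in> iso (relative_homology_group p D D') (relative_homology_group p X X')"
    using D(1) hom_induced_hom by (rule iso_left_factor)
  from iso_set_trans[OF D(2) this]
  have "hom_induced p D D' X X' \<Phi> \<circ> hom_induced p D S D D' id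
      \<in> iso (relative_homology_group p D S) (relative_homology_group p X X')"
    by (simp add: compose_def)
  \<comment> \<open>Second square: \<Phi> commutes with enlarging the subspaces. Its one remaining
    side is the map in question.\<close>
  also have "hom_induced p D D' X X' \<Phi> \<circ> hom_induced p D S D D' id
      = hom_induced p X A X X' id \<circ> hom_induced p D S X A \<Phi>"
    (is "?k \<circ> ?id = ?ix \<circ> ?f")
  proof -
    have "d \<notin> S" "\<Phi> d \<notin> A"
      using d DS \<Phi>open by blast+
    then have sub: "S \<subseteq> D'" "A \<subseteq> X'"
      using closedin_subset[OF closedin_A] std_sphere_subset[of n] by (auto simp: S_def D_def D'_def X'_def)
    have "?k \<circ> ?id = hom_induced p D S X X' (\<Phi> \<circ> id)"
      using cont \<Phi>D' sub by (intro hom_induced_compose[symmetric]) auto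
    moreover have "?ix \<circ> ?f = hom_induced p D S X X' (id \<circ> \<Phi>)"
      using cont char_map_sphere sub by (intro hom_induced_compose[symmetric]) (auto simp: S_def)
    ultimately show ?thesis
      by simp
  qed
  finally show ?thesis
    using X(2) hom_induced_hom unfolding D_def S_def by (rule iso_right_factor)
qed

end

section \<open>Homology of the disc relative to its boundary sphere\<close>

lemma contractible_space_std_disc: "contractible_space (std_disc n)"
proof -
  have "homotopic_with (\<lambda>h. True) (std_disc n) (std_disc n) id (\<lambda>x i. 0)"
  proof -
    have "continuous_on ({0..1} \<times> topspace (std_disc n)) (\<lambda>(t::real, y::nat\<Rightarrow>real) i. (1 - t) * y i)"
      unfolding case_prod_unfold
      by (intro continuous_on_coordinatewise_then_product continuous_intros
          continuous_on_product_then_coordinatewise[OF continuous_on_snd])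
    moreover have "(\<lambda>(t::real, y::nat\<Rightarrow>real) i. (1 - t) * y i) ` ({0..1} \<times> topspace (std_disc n))
        \<subseteq> topspace (std_disc n)"
      using std_disc_convex[of _ n "\<lambda>i. 0"] by (fastforce simp: topspace_std_disc)
    ultimately have "continuous_map (prod_topology (top_of_set {0..1}) (std_disc n)) (std_disc n)
        (\<lambda>(t, y) i. (1 - t) * y i)"
      by (subst (1 2) std_disc_eq_top_of_set)
        (simp add: euclidean_product_topology image_subset_iff_funcset)
    then show ?thesis
      by (auto simp: homotopic_with_def)
  qed
  then show ?thesis
    by (auto simp: contractible_space_def)
qed

text \<open>For \<open>n > 0\<close> the disc is contractible and the sphere nonempty, so the group
  is the reduced homology of the sphere one degree lower. For \<open>n = 0\<close> it is the
  homology of a point.\<close>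

lemma relative_homology_std_disc_integer:
  "relative_homology_group (int n) (std_disc n) (std_sphere n) \<cong> integer_group"
proof (cases n)
  case 0
  have "topspace (std_disc 0) = {\<lambda>i. 0}" "std_sphere 0 = {}"
    by (auto simp: topspace_std_disc std_sphere_def)
  then show ?thesis
    using 0 homology_coefficients by simp
next
  case (Suc m)
  have "subtopology (std_disc n) (std_sphere n) = nsphere m"
  proof -
    have "{x. (\<Sum>i<Suc m. (x i)\<^sup>2) \<le> 1} \<inter> std_sphere (Suc m) = topspace (Euclidean_space (Suc m)) \<inter> {x. (\<Sum>i\<le>m. (x i)\<^sup>2) = 1}"
      by (auto simp: std_sphere_def topspace_std_disc topspace_Euclidean_space lessThan_Suc_atMost)
    then show ?thesis
      using Suc
      by (simp add: std_disc_def nsphere_def subtopology_subtopology) (metis subtopology_restrict)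
  qed
  moreover have "topspace (std_disc n) \<inter> std_sphere n \<noteq> {}"
  proof -
    have "(\<lambda>i. if i = 0 then 1 else 0) \<in> std_sphere (Suc m)"
      by (simp add: std_sphere_def topspace_std_disc if_distrib[of "\<lambda>x. x\<^sup>2"] cong: if_cong)
    then show ?thesis
      using Suc std_sphere_subset by blast
  qed
  ultimately have "relative_homology_group (int n) (std_disc n) (std_sphere n)
      \<cong> reduced_homology_group (int n - 1) (nsphere m)"
    using isomorphic_group_relative_homology_of_contractible[OF contractible_space_std_disc[of n]]
    by metis
  also have "int n - 1 = int m"
    using Suc by simp
  finally show ?thesis
    using reduced_homology_group_nsphere(1) iso_trans by blast
qed

text \<open>In the integers the generator becomes a number that has \<open>1\<close> among its
  multiples; such a number is nonzero and has no vanishing nonzero multiple.\<close>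

lemma infinite_cyclic_generator_pow:
  assumes "group G" "G \<cong> integer_group" "w \<in> carrier G" "generate G {w} = carrier G"
  shows "w [^]\<^bsub>G\<^esub> (k::int) = \<one>\<^bsub>G\<^esub> \<longleftrightarrow> k = 0"
proof -
  interpret group G by fact
  obtain h where h: "h \<in> iso G integer_group"
    using assms(2) by (auto simp: is_iso_def)
  interpret h: group_hom G integer_group h
    using h by (auto simp: group_hom_def group_hom_axioms_def iso_def)
  have "1 \<in> h ` carrier G"
    using h by (auto simp: iso_def bij_betw_def)
  then obtain i :: int where "h (w [^]\<^bsub>G\<^esub> i) = 1"
    using generate_pow[OF \<open>w \<in> carrier G\<close>] assms(4) by auto
  then have "h w \<noteq> 0"
    using h.hom_int_pow[OF \<open>w \<in> carrier G\<close>] by auto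
  then show ?thesis
    using h.hom_int_pow[OF \<open>w \<in> carrier G\<close>, of k] h.hom_one by auto
qed


section \<open>Cellular homology of finite CW complexes\<close>

text \<open>Meant for homomorphisms into a cell group, where all images are powers of one element
  and an identity in homology becomes a sum of exponents.\<close>

lemma hom_finprod_int_pow:
  assumes "comm_group G" "comm_group H" "h \<in> hom G H" "finite F"
    and "\<And>t. t \<in> F \<Longrightarrow> c t \<in> carrier G" "w \<in> carrier H"
    and "\<And>t. t \<in> F \<Longrightarrow> h (c t) = w [^]\<^bsub>H\<^esub> (b t :: int)"
  shows "h (finprod G (\<lambda>t. c t [^]\<^bsub>G\<^esub> (a t :: int)) F) = w [^]\<^bsub>H\<^esub> (\<Sum>t\<in>F. b t * a t)"
  using assms(4,5,7)
proof (induction F rule: finite_induct)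
  interpret G: comm_group G by fact
  interpret H: comm_group H by fact
  interpret h: group_hom G H h
    using assms(3) by unfold_locales
  {
    case empty
    then show ?case
      by simp
  next
    case (insert t F)
    then have "(\<lambda>t. c t [^]\<^bsub>G\<^esub> a t) \<in> F \<rightarrow> carrier G" "c t [^]\<^bsub>G\<^esub> a t \<in> carrier G"
      by auto
    then show ?case
      using insert assms(6)
      by (simp add: G.finprod_insert G.finprod_closed H.int_pow_pow H.int_pow_mult h.hom_int_pow)
  }
qed

text \<open>The skeleton as a set of cells instead of points. A set of cells between two consecutive
  ones describes a skeleton with only some of its top cells attached.\<close>

definition cells_upto :: "'a cw_complex \<Rightarrow> int \<Rightarrow> 'a set set" where
  "cells_upto K m = {s \<in> cells K. int (cell_dim K s) \<le> m}"

lemma skeleton_eq_Union: "skeleton K m = \<Union>(cells_upto K m)"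
  by (simp add: skeleton_def cells_upto_def)

lemma skeleton_mono: "m \<le> m' \<Longrightarrow> skeleton K m \<subseteq> skeleton K m'"
  by (auto simp: skeleton_def)

locale finite_cw =
  fixes K :: "'a cw_complex"
  assumes finite_cw_complex: "finite_cw_complex K"
begin

lemma Hausdorff_space: "Hausdorff_space (space K)"
  and finite_cells: "finite (cells K)"
  and disjoint_cells: "disjoint (cells K)"
  and Union_cells: "\<Union>(cells K) = topspace (space K)"
  using finite_cw_complex by (auto simp: finite_cw_complex_def)

lemma
  assumes "s \<in> cells K"
  shows continuous_char_map: "continuous_map (std_disc (cell_dim K s)) (space K) (char_map K s)"
    and char_map_homeomorphic: "homeomorphic_map
      (subtopology (std_disc (cell_dim K s)) (std_open_disc (cell_dim K s)))
      (subtopology (space K) s) (char_map K s)"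
    and char_map_sphere: "char_map K s ` std_sphere (cell_dim K s) \<subseteq> skeleton K (int (cell_dim K s) - 1)"
    and orientation_carrier: "orientation K s \<in> carrier (relative_homology_group (int (cell_dim K s))
      (std_disc (cell_dim K s)) (std_sphere (cell_dim K s)))"
    and orientation_generates: "generate (relative_homology_group (int (cell_dim K s))
        (std_disc (cell_dim K s)) (std_sphere (cell_dim K s))) {orientation K s}
      = carrier (relative_homology_group (int (cell_dim K s))
        (std_disc (cell_dim K s)) (std_sphere (cell_dim K s)))"
  using finite_cw_complex assms unfolding finite_cw_complex_def Let_def by blast+

lemma cell_subset_topspace: "s \<in> cells K \<Longrightarrow> s \<subseteq> topspace (space K)"
  using Union_cells by blast

lemma bij_char_map: "s \<in> cells K \<Longrightarrow> bij_betw (char_map K s) (std_open_disc (cell_dim K s)) s"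
  using char_map_homeomorphic[of s] cell_subset_topspace[of s] std_open_disc_subset[of "cell_dim K s"]
  by (simp add: homeomorphic_eq_everything_map bij_betw_def inf.absorb2)

lemma char_map_disc:
  "s \<in> cells K \<Longrightarrow> char_map K s ` topspace (std_disc (cell_dim K s))
     = s \<union> char_map K s ` std_sphere (cell_dim K s)"
  using bij_char_map[of s]
  by (simp flip: std_open_disc_Un_sphere add: image_Un bij_betw_def)

lemma Union_cells_Diff: "S \<subseteq> cells K \<Longrightarrow> t \<in> cells K \<Longrightarrow> \<Union>(S - {t}) = \<Union>S - t"
  using disjoint_cells unfolding disjoint_def by blast

lemma char_map_disc_subset:
  assumes "s \<in> cells K" "cells_upto K (int (cell_dim K s) - 1) \<subseteq> S" "s \<in> S"
  shows "char_map K s ` topspace (std_disc (cell_dim K s)) \<subseteq> \<Union>S"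
  using char_map_disc[OF assms(1)] char_map_sphere[OF assms(1)] assms(2,3)
  unfolding skeleton_eq_Union by blast

lemma closedin_char_map_disc:
  "s \<in> cells K \<Longrightarrow> closedin (space K) (char_map K s ` topspace (std_disc (cell_dim K s)))"
  using continuous_char_map compact_space_std_disc Hausdorff_space
  by (metis closed_map_def closedin_topspace continuous_imp_closed_map)

text \<open>The set is the finite union of the compact images of the closed discs of its cells: the
  boundary of each cell is covered by cells of lower dimension, which all belong to
  \<open>S\<close>.\<close>

lemma closedin_Union_cells:
  assumes "cells_upto K (n - 1) \<subseteq> S" "S \<subseteq> cells_upto K n"
  shows "closedin (space K) (\<Union>S)"
proof -
  have S: "S \<subseteq> cells K"
    using assms by (auto simp: cells_upto_def)
  have sub: "char_map K s ` topspace (std_disc (cell_dim K s)) \<subseteq> \<Union>S" if "s \<in> S" for s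
  proof (rule char_map_disc_subset)
    show "s \<in> cells K" "s \<in> S"
      using S that by auto
    show "cells_upto K (int (cell_dim K s) - 1) \<subseteq> S"
      using assms that by (force simp: cells_upto_def)
  qed
  have "s \<subseteq> (\<Union>s\<in>S. char_map K s ` topspace (std_disc (cell_dim K s)))" if "s \<in> S" for s
    using char_map_disc[of s] S that by (intro order_trans[OF _ UN_upper[OF that]]) auto
  then have "\<Union>S = (\<Union>s\<in>S. char_map K s ` topspace (std_disc (cell_dim K s)))"
    using sub by (intro equalityI Sup_least UN_least)
  moreover have "closedin (space K) (\<Union>s\<in>S. char_map K s ` topspace (std_disc (cell_dim K s)))"
    using S finite_subset[OF S finite_cells] closedin_char_map_disc by (intro closedin_Union) auto
  ultimately show ?thesis
    by simp
qed

text \<open>Any \<open>n\<close>-cell of \<open>S\<close> can be regarded as the last one attached,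
  since the other cells form a closed set containing the image of its boundary sphere.\<close>

lemma cell_attachment_cell:
  assumes "cells_upto K (int n - 1) \<subseteq> S" "S \<subseteq> cells_upto K (int n)" "t \<in> S" "cell_dim K t = n"
  shows "cell_attachment (subtopology (space K) (\<Union>S)) (\<Union>S - t) n (char_map K t)"
proof
  have S: "S \<subseteq> cells K" and t: "t \<in> cells K"
    using assms by (auto simp: cells_upto_def)
  have lower: "cells_upto K (int n - 1) \<subseteq> S - {t}"
    using assms by (auto simp: cells_upto_def)
  have diff: "\<Union>(S - {t}) = \<Union>S - t"
    using Union_cells_Diff[OF S t] .
  show "Hausdorff_space (subtopology (space K) (\<Union>S))"
    by (simp add: Hausdorff_space Hausdorff_space_subtopology)
  have "closedin (space K) (\<Union>(S - {t}))"
    using lower assms(2) by (intro closedin_Union_cells) auto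
  then show "closedin (subtopology (space K) (\<Union>S)) (\<Union>S - t)"
    using diff by (metis Diff_subset closedin_subset_topspace closedin_subtopology_Int_closed inf.absorb_iff2)
  show "continuous_map (std_disc n) (subtopology (space K) (\<Union>S)) (char_map K t)"
    using continuous_char_map[OF t] char_map_disc_subset[OF t, of S] assms
    by (simp add: continuous_map_in_subtopology image_subset_iff_funcset)
  show "char_map K t ` std_sphere n \<subseteq> \<Union>S - t"
    using char_map_sphere[OF t] Union_mono[OF lower] diff assms(4) unfolding skeleton_eq_Union by simp
  have "topspace (subtopology (space K) (\<Union>S)) - (\<Union>S - t) = t"
    using assms(3) cell_subset_topspace[OF t] by auto
  then show "bij_betw (char_map K t) (std_open_disc n)
      (topspace (subtopology (space K) (\<Union>S)) - (\<Union>S - t))"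
    using bij_char_map[OF t] assms(4) by simp
qed

section \<open>Local projections at the cells\<close>

definition cell_proj :: "'a set \<Rightarrow> 'a chain set \<Rightarrow> 'a chain set" where
  "cell_proj t = (let n = int (cell_dim K t); X = subtopology (space K) (skeleton K n) in
     hom_induced n X (skeleton K (n - 1)) X (skeleton K n - t) id)"

text \<open>Infinite cyclic for a cell \<open>t\<close>, through
  \<open>iso_char_map_cell_group\<close>; thus \<open>cell_proj t\<close> acts as the coordinate at
  \<open>t\<close>.\<close>

definition cell_group :: "'a set \<Rightarrow> 'a chain set monoid" where
  "cell_group t = (let n = int (cell_dim K t) in
     relative_homology_group n (subtopology (space K) (skeleton K n)) (skeleton K n - t))"

lemma comm_group_skeletal_homology: "comm_group (skeletal_homology K m)"
  and comm_group_cell_group: "comm_group (cell_group t)"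
  by (auto simp: skeletal_homology_def cell_group_def Let_def)

lemma cell_class_carrier: "cell_class K t \<in> carrier (skeletal_homology K (int (cell_dim K t)))"
  by (simp add: cell_class_def skeletal_homology_def Let_def hom_induced_carrier)

lemma cell_proj_hom: "cell_proj t \<in> hom (skeletal_homology K (int (cell_dim K t))) (cell_group t)"
  by (simp add: cell_proj_def cell_group_def skeletal_homology_def Let_def hom_induced_hom)

lemma skeleton_Diff_cell:
  assumes "t \<in> cells K"
  shows "skeleton K (int (cell_dim K t) - 1) \<subseteq> skeleton K (int (cell_dim K t)) - t"
proof -
  have "cells_upto K (int (cell_dim K t) - 1) \<subseteq> cells_upto K (int (cell_dim K t)) - {t}"
    by (auto simp: cells_upto_def)
  moreover have "cells_upto K (int (cell_dim K t)) \<subseteq> cells K"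
    by (auto simp: cells_upto_def)
  ultimately show ?thesis
    using Union_cells_Diff[of "cells_upto K (int (cell_dim K t))" t] assms
    unfolding skeleton_eq_Union by blast
qed

lemma char_map_skeleton:
  assumes "s \<in> cells K"
  shows "continuous_map (std_disc (cell_dim K s)) (subtopology (space K) (skeleton K (int (cell_dim K s)))) (char_map K s)"
    and "char_map K s ` topspace (std_disc (cell_dim K s)) \<subseteq> skeleton K (int (cell_dim K s))"
proof -
  show *: "char_map K s ` topspace (std_disc (cell_dim K s)) \<subseteq> skeleton K (int (cell_dim K s))"
    unfolding skeleton_eq_Union using assms
    by (intro char_map_disc_subset) (auto simp: cells_upto_def)
  show "continuous_map (std_disc (cell_dim K s)) (subtopology (space K) (skeleton K (int (cell_dim K s)))) (char_map K s)"
    using * continuous_char_map[OF assms]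
    by (simp add: continuous_map_in_subtopology image_subset_iff_funcset)
qed

lemma cell_proj_cell_class:
  assumes s: "s \<in> cells K" and t: "t \<in> cells K" and dim: "cell_dim K s = cell_dim K t"
  shows "cell_proj t (cell_class K s) = hom_induced (int (cell_dim K t)) (std_disc (cell_dim K t))
    (std_sphere (cell_dim K t)) (subtopology (space K) (skeleton K (int (cell_dim K t))))
    (skeleton K (int (cell_dim K t)) - t) (char_map K s) (orientation K s)"
  unfolding cell_proj_def cell_class_def Let_def dim
  using char_map_skeleton[OF s] char_map_sphere[OF s] skeleton_Diff_cell[OF t]
  by (subst hom_induced_compose') (auto simp: dim)

text \<open>The closed disc of \<open>s\<close> maps into \<open>s\<close> and lower cells, all
  disjoint from \<open>t\<close>, so it lands in the subspace that is divided out.\<close>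

lemma cell_proj_cell_class_other:
  assumes "s \<in> cells K" "t \<in> cells K" "cell_dim K s = cell_dim K t" "s \<noteq> t"
  shows "cell_proj t (cell_class K s) = \<one>\<^bsub>cell_group t\<^esub>"
proof -
  have "char_map K s ` topspace (std_disc (cell_dim K t)) \<subseteq> skeleton K (int (cell_dim K t)) - t"
  proof -
    have "s \<inter> t = {}"
      using assms disjoint_cells by (auto simp: disjoint_def)
    then show ?thesis
      using char_map_skeleton(2)[OF assms(1)] char_map_disc[OF assms(1)] char_map_sphere[OF assms(1)]
        skeleton_Diff_cell[OF assms(2)] assms(3) by auto
  qed
  then show ?thesis
    using char_map_skeleton[OF assms(1)] assms(3) std_sphere_subset
    by (simp add: cell_proj_cell_class[OF assms(1-3)] cell_group_def Let_def hom_induced_into_subset)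
qed

text \<open>The skeleton arises from the complement of \<open>t\<close> by attaching
  \<open>t\<close> last.\<close>

lemma iso_char_map_cell_group:
  assumes "t \<in> cells K"
  shows "hom_induced (int (cell_dim K t)) (std_disc (cell_dim K t))
    (std_sphere (cell_dim K t)) (subtopology (space K) (skeleton K (int (cell_dim K t))))
    (skeleton K (int (cell_dim K t)) - t) (char_map K t)
   \<in> iso (relative_homology_group (int (cell_dim K t)) (std_disc (cell_dim K t)) (std_sphere (cell_dim K t)))
         (cell_group t)"
proof -
  interpret cell_attachment "subtopology (space K) (skeleton K (int (cell_dim K t)))"
    "skeleton K (int (cell_dim K t)) - t" "cell_dim K t" "char_map K t"
    unfolding skeleton_eq_Union using assms by (intro cell_attachment_cell) (auto simp: cells_upto_def)
  show ?thesis
    using iso_homology_char_map[of "int (cell_dim K t)"] by (simp add: cell_group_def Let_def)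
qed

text \<open>The projected class is the image of the orientation, a generator of an infinite cyclic
  group, under an isomorphism.\<close>

lemma cell_proj_cell_class_pow:
  assumes t: "t \<in> cells K"
  shows "cell_proj t (cell_class K t) [^]\<^bsub>cell_group t\<^esub> (k::int) = \<one>\<^bsub>cell_group t\<^esub> \<longleftrightarrow> k = 0"
proof -
  define G where "G = relative_homology_group (int (cell_dim K t)) (std_disc (cell_dim K t)) (std_sphere (cell_dim K t))"
  define h where "h = hom_induced (int (cell_dim K t)) (std_disc (cell_dim K t))
    (std_sphere (cell_dim K t)) (subtopology (space K) (skeleton K (int (cell_dim K t))))
    (skeleton K (int (cell_dim K t)) - t) (char_map K t)"
  have iso: "h \<in> iso G (cell_group t)"
    unfolding h_def G_def by (rule iso_char_map_cell_group[OF t])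
  interpret H: comm_group "cell_group t"
    by (rule comm_group_cell_group)
  interpret h: group_hom G "cell_group t" h
    using iso by (auto simp: group_hom_def group_hom_axioms_def iso_def G_def)
  have o: "orientation K t \<in> carrier G"
    using orientation_carrier[OF t] by (simp add: G_def)
  have "cell_proj t (cell_class K t) = h (orientation K t)"
    using cell_proj_cell_class[OF t t refl] by (simp add: h_def)
  then have "cell_proj t (cell_class K t) [^]\<^bsub>cell_group t\<^esub> k = h (orientation K t [^]\<^bsub>G\<^esub> k)"
    using h.hom_int_pow[OF o] by simp
  moreover have "h x = \<one>\<^bsub>cell_group t\<^esub> \<longleftrightarrow> x = \<one>\<^bsub>G\<^esub>" if "x \<in> carrier G" for x
    using iso that by (metis h.G.one_closed h.hom_one inj_onD iso_iff h.iso_iff)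
  moreover have "orientation K t [^]\<^bsub>G\<^esub> k = \<one>\<^bsub>G\<^esub> \<longleftrightarrow> k = 0"
    using o orientation_generates[OF t] relative_homology_std_disc_integer
    by (intro infinite_cyclic_generator_pow) (auto simp: G_def)
  ultimately show ?thesis
    using o by simp
qed

text \<open>All factors other than the one at \<open>t\<close> die under the projection, so the
  exponent at \<open>t\<close> can be read off.\<close>

lemma cell_proj_finprod:
  assumes t: "t \<in> cells K"
  defines "F \<equiv> {s \<in> cells K. cell_dim K s = cell_dim K t}"
    and "G \<equiv> skeletal_homology K (int (cell_dim K t))"
  shows "cell_proj t (finprod G (\<lambda>s. cell_class K s [^]\<^bsub>G\<^esub> (a s :: int)) F)
    = cell_proj t (cell_class K t) [^]\<^bsub>cell_group t\<^esub> a t"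
proof -
  interpret G: comm_group G
    unfolding G_def by (rule comm_group_skeletal_homology)
  interpret H: comm_group "cell_group t"
    by (rule comm_group_cell_group)
  have w: "cell_proj t (cell_class K t) \<in> carrier (cell_group t)"
    using cell_proj_hom cell_class_carrier by (metis hom_in_carrier)
  have F: "finite F" "t \<in> F"
    using t finite_cells by (auto simp: F_def)
  have "cell_proj t (finprod G (\<lambda>s. cell_class K s [^]\<^bsub>G\<^esub> a s) F)
    = cell_proj t (cell_class K t) [^]\<^bsub>cell_group t\<^esub> (\<Sum>s\<in>F. (if s = t then 1 else 0) * a s)"
  proof (rule hom_finprod_int_pow)
    show "cell_proj t \<in> hom G (cell_group t)"
      unfolding G_def by (rule cell_proj_hom)
    show "cell_class K s \<in> carrier G" if "s \<in> F" for s
      using that cell_class_carrier[of s] by (simp add: F_def G_def)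
    show "cell_proj t (cell_class K s) = cell_proj t (cell_class K t) [^]\<^bsub>cell_group t\<^esub> (if s = t then 1 else 0 :: int)"
      if "s \<in> F" for s
      using that w cell_proj_cell_class_other[of s t] t by (simp add: F_def H.int_pow_1)
  qed (use w F G.comm_group_axioms H.comm_group_axioms in auto)
  also have "(\<Sum>s\<in>F. (if s = t then 1 else 0) * a s) = (\<Sum>s\<in>F. if s = t then a s else 0)"
    by (intro sum.cong) auto
  finally show ?thesis
    using F by simp
qed

end

text \<open>The composite contains two consecutive maps
  \<open>H(S) \<rightarrow> H(S, T) \<rightarrow> H(T)\<close> of one long exact sequence.\<close>

lemma hom_relboundary_relboundary:
  "hom_relboundary (p - 1) (subtopology X S) T U (hom_relboundary p X S T c)
    = \<one>\<^bsub>relative_homology_group (p - 2) (subtopology (subtopology X S) T) U\<^esub>"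
proof -
  let ?Y = "subtopology X S"
  have "hom_boundary (p - 1) ?Y T (hom_induced (p - 1) ?Y {} ?Y T id y)
      = \<one>\<^bsub>homology_group (p - 2) (subtopology ?Y T)\<^esub>"
    if "y \<in> carrier (homology_group (p - 1) ?Y)" for y
    using homology_exactness_axiom_1[of "p - 1" ?Y T] that by (auto simp: kernel_def)
  from this[OF hom_boundary_carrier[of p X S c]] show ?thesis
    using hom_one[OF hom_induced_hom] by (simp add: hom_relboundary_def)
qed

section \<open>Cell classes generate the skeletal homology\<close>

context finite_cw
begin

text \<open>The top cells are attached one at a time. When \<open>t\<close> is added, exactness for
  the triple \<open>A \<subseteq> A' \<subseteq> Y\<close> shows that a class differs from a
  multiple of the class of \<open>t\<close> by a class of the previous stage.\<close>

lemma cell_class_generate_stage: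
  fixes n :: nat
  defines "A \<equiv> skeleton K (int n - 1)"
    and "G \<equiv> skeletal_homology K (int n)"
  assumes "finite T" "T \<subseteq> {t \<in> cells K. cell_dim K t = n}"
    and "x \<in> carrier (relative_homology_group (int n) (subtopology (space K) (A \<union> \<Union>T)) A)"
  shows "\<exists>a. hom_induced (int n) (subtopology (space K) (A \<union> \<Union>T)) A
      (subtopology (space K) (skeleton K (int n))) A id x
    = finprod G (\<lambda>t. cell_class K t [^]\<^bsub>G\<^esub> (a t :: int)) T"
  using assms(3-5)
proof (induction T arbitrary: x rule: finite_induct)
  interpret G: comm_group G
    unfolding G_def by (rule comm_group_skeletal_homology)
  define Y where "Y = (\<lambda>T. subtopology (space K) (A \<union> \<Union>T))"
  define e where "e = (\<lambda>T. hom_induced (int n) (Y T) A (subtopology (space K) (skeleton K (int n))) A id)"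
  have e_hom: "e T \<in> hom (relative_homology_group (int n) (Y T) A) G" for T
    by (simp add: e_def G_def A_def skeletal_homology_def hom_induced_hom)
  have Y_sub: "A \<union> \<Union>T \<subseteq> skeleton K (int n)" if "T \<subseteq> {t \<in> cells K. cell_dim K t = n}" for T
    using that skeleton_mono[of "int n - 1" "int n" K] by (auto simp: A_def skeleton_def)
  have Y_id: "continuous_map (Y T) (subtopology (space K) (skeleton K (int n))) id"
    if "T \<subseteq> {t \<in> cells K. cell_dim K t = n}" for T
    unfolding Y_def continuous_map_in_subtopology
    using Y_sub[OF that] by (auto simp: continuous_map_from_subtopology)
  {
    case empty
    have "trivial_group (relative_homology_group (int n) (Y {}) A)"
      using trivial_relative_homology_group_topspace[of "int n" "Y {}"]
      by (simp add: Y_def) (metis inf.idem relative_homology_group_restrict topspace_subtopology inf_assoc)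
    then have "x = \<one>\<^bsub>relative_homology_group (int n) (Y {}) A\<^esub>"
      using empty by (simp add: trivial_group_def Y_def)
    then have "e {} x = \<one>\<^bsub>G\<^esub>"
      using hom_one[OF e_hom] by simp
    then show ?case
      by (simp add: e_def Y_def id_def)
  next
    case (insert t T)
    define A' where "A' = A \<union> \<Union>T"
    let ?Y = "Y (insert t T)"
    have t: "t \<in> cells K" "cell_dim K t = n" and T: "T \<subseteq> {t \<in> cells K. cell_dim K t = n}"
      using insert.prems by auto
    define S where "S = cells_upto K (int n - 1) \<union> insert t T"
    have US: "\<Union>S = A \<union> \<Union>(insert t T)"
      by (auto simp: S_def A_def skeleton_eq_Union)
    have "S - {t} = cells_upto K (int n - 1) \<union> T"
      using t insert.hyps by (auto simp: S_def cells_upto_def)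
    then have A': "A' = \<Union>S - t"
      using Union_cells_Diff[of S t] t T by (auto simp: S_def A'_def A_def skeleton_eq_Union cells_upto_def)
    interpret cell_attachment ?Y A' n "char_map K t"
      unfolding Y_def A' US[symmetric] using t T
      by (intro cell_attachment_cell) (auto simp: S_def cells_upto_def)
    define C where "C = relative_homology_group (int n) (std_disc n) (std_sphere n)"
    define H where "H = relative_homology_group (int n) ?Y A"
    define H' where "H' = relative_homology_group (int n) ?Y A'"
    define j where "j = hom_induced (int n) ?Y A ?Y A' id"
    define i where "i = hom_induced (int n) (Y T) A ?Y A id"
    define f where "f = hom_induced (int n) (std_disc n) (std_sphere n) ?Y A' (char_map K t)"
    \<comment> \<open>The boundary sphere of \<open>t\<close> already maps into the lower skeleton
      \<open>A\<close>, so the characteristic map also gives a lift \<open>g\<close> of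
      \<open>f\<close> through \<open>j\<close>.\<close>
    define g where "g = hom_induced (int n) (std_disc n) (std_sphere n) ?Y A (char_map K t)"
    have sphere: "char_map K t ` std_sphere n \<subseteq> A"
      using finite_cw.char_map_sphere[OF finite_cw_axioms t(1)] t(2) by (simp add: A_def)
    have f: "f \<in> iso C H'"
      unfolding f_def C_def H'_def by (rule iso_homology_char_map)
    have g: "g \<in> hom C H"
      unfolding g_def C_def H_def by (rule hom_induced_hom)
    have jg: "j (g c) = f c" for c
      unfolding j_def g_def f_def using continuous_char_map sphere
      by (subst hom_induced_compose') (auto simp: A'_def)
    have eg: "e (insert t T) (g (orientation K t)) = cell_class K t"
    proof -
      have "e (insert t T) (g (orientation K t)) = hom_induced (int n) (std_disc n) (std_sphere n)
          (subtopology (space K) (skeleton K (int n))) A (id \<circ> char_map K t) (orientation K t)"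
        unfolding e_def g_def using continuous_char_map sphere Y_id[OF insert.prems(1)]
        by (subst hom_induced_compose') auto
      then show ?thesis
        by (simp add: cell_class_def Let_def t A_def)
    qed
    have "continuous_map (Y T) ?Y id"
      by (auto simp: Y_def continuous_map_in_subtopology continuous_map_from_subtopology)
    then have ei: "e (insert t T) (i w) = e T w" for w
      unfolding e_def i_def using Y_id[OF insert.prems(1)]
      by (subst hom_induced_compose') auto
    interpret e: group_hom H G "e (insert t T)"
      using e_hom by (simp add: group_hom_def group_hom_axioms_def H_def)
    interpret j: group_hom H H' j
      by (simp add: group_hom_def group_hom_axioms_def H_def H'_def j_def hom_induced_hom)
    interpret g: group_hom C H g
      using g by (simp add: group_hom_def group_hom_axioms_def H_def C_def)
    interpret f: group_hom C H' f
      using f by (simp add: group_hom_def group_hom_axioms_def H'_def C_def iso_def)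
    have o: "orientation K t \<in> carrier C" "generate C {orientation K t} = carrier C"
      using orientation_carrier[OF t(1)] orientation_generates[OF t(1)] t(2) by (auto simp: C_def)
    have x: "x \<in> carrier H"
      using insert.prems(2) by (simp add: H_def Y_def)
    then have "j x \<in> f ` {orientation K t [^]\<^bsub>C\<^esub> k |k. k \<in> (UNIV :: int set)}"
      using f o(2) g.G.generate_pow[OF o(1)] by (auto simp: iso_def bij_betw_def)
    then obtain k :: int where k: "j x = f (orientation K t [^]\<^bsub>C\<^esub> k)"
      by blast
    \<comment> \<open>The multiple of the class of \<open>t\<close> with the same image under
      \<open>j\<close> as \<open>x\<close>; the difference then comes from the previous
      stage.\<close>
    define u where "u = g (orientation K t) [^]\<^bsub>H\<^esub> k"
    have u: "u \<in> carrier H" "j u = j x"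
      using o jg k by (auto simp: u_def simp flip: g.hom_int_pow)
    have "j (x \<otimes>\<^bsub>H\<^esub> inv\<^bsub>H\<^esub> u) = \<one>\<^bsub>H'\<^esub>"
      using x u by simp
    moreover have "kernel H H' j = i ` carrier (relative_homology_group (int n) (Y T) A)"
    proof -
      have "subtopology ?Y A' = Y T"
        by (simp add: Y_def A'_def subtopology_subtopology Int_absorb1 inf.absorb2) (metis Un_upper1 inf.absorb2 sup.assoc sup_commute)
      then show ?thesis
        using homology_exactness_triple_3[of A A' "int n" ?Y]
        by (simp add: A'_def[symmetric] H_def H'_def j_def i_def) (simp add: A'_def)
    qed
    ultimately have "x \<otimes>\<^bsub>H\<^esub> inv\<^bsub>H\<^esub> u \<in> i ` carrier (relative_homology_group (int n) (Y T) A)"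
      using x u by (metis (mono_tags, lifting) e.G.inv_closed e.G.m_closed kernel_def mem_Collect_eq)
    then obtain w where w: "w \<in> carrier (relative_homology_group (int n) (Y T) A)"
      "x \<otimes>\<^bsub>H\<^esub> inv\<^bsub>H\<^esub> u = i w"
      by blast
    then have "x = i w \<otimes>\<^bsub>H\<^esub> u"
      using x u by (metis e.G.inv_closed e.G.inv_solve_right' e.G.m_assoc e.G.l_inv e.G.r_one e.G.m_closed)
    moreover have "i w \<in> carrier H"
      by (simp add: i_def H_def hom_induced_carrier)
    ultimately have "e (insert t T) x = e T w \<otimes>\<^bsub>G\<^esub> cell_class K t [^]\<^bsub>G\<^esub> k"
      using u o eg by (simp add: ei u_def e.hom_int_pow)
    moreover obtain a where a: "e T w = finprod G (\<lambda>t. cell_class K t [^]\<^bsub>G\<^esub> (a t :: int)) T"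
      using insert.IH[OF T] w(1) by (auto simp: e_def Y_def id_def)
    moreover have class_carrier: "cell_class K s \<in> carrier G" if "s \<in> cells K" "cell_dim K s = n" for s
      using that cell_class_carrier[of s] by (simp add: G_def)
    moreover have "finprod G (\<lambda>s. cell_class K s [^]\<^bsub>G\<^esub> (if s = t then k else a s)) T
        = finprod G (\<lambda>s. cell_class K s [^]\<^bsub>G\<^esub> a s) T"
      using insert.hyps T class_carrier by (intro G.finprod_cong') auto
    ultimately have "e (insert t T) x
        = finprod G (\<lambda>s. cell_class K s [^]\<^bsub>G\<^esub> (if s = t then k else a s)) (insert t T)"
      using insert.hyps t T
      by (subst G.finprod_insert) (auto simp: G.m_comm G.finprod_closed Pi_iff subset_iff)
    then show ?case
      by (intro exI[of _ "\<lambda>s. if s = t then k else a s"]) (simp add: e_def Y_def id_def)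
  }
qed

lemma cell_class_generate:
  fixes n :: nat
  defines "G \<equiv> skeletal_homology K (int n)"
  assumes "x \<in> carrier G"
  shows "\<exists>a. x = finprod G (\<lambda>t. cell_class K t [^]\<^bsub>G\<^esub> (a t :: int)) {t \<in> cells K. cell_dim K t = n}"
proof -
  have "skeleton K (int n - 1) \<union> \<Union>{t \<in> cells K. cell_dim K t = n} = skeleton K (int n)"
    by (force simp: skeleton_def)
  then show ?thesis
    using cell_class_generate_stage[of "{t \<in> cells K. cell_dim K t = n}" n x] assms finite_cells
    by (simp add: skeletal_homology_def hom_induced_id)
qed

section \<open>Incidence numbers: coordinates, square of the boundary, closures\<close>

lemma subtopology_skeleton:
  "m \<le> m' \<Longrightarrow> subtopology (subtopology (space K) (skeleton K m')) (skeleton K m)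
    = subtopology (space K) (skeleton K m)"
  using skeleton_mono[of m m' K] by (simp add: subtopology_subtopology Int_absorb1)

lemma skeletal_relboundary_hom:
  "hom_relboundary m (subtopology (space K) (skeleton K m)) (skeleton K (m - 1)) (skeleton K (m - 2))
   \<in> hom (skeletal_homology K m) (skeletal_homology K (m - 1))"
  using group_homomorphism_hom_relboundary[of m "subtopology (space K) (skeleton K m)"
      "skeleton K (m - 1)" "skeleton K (m - 2)"]
  by (simp add: skeletal_homology_def subtopology_skeleton)

lemma cell_boundary_class_carrier:
  "cell_boundary_class K s \<in> carrier (skeletal_homology K (int (cell_dim K s) - 1))"
  unfolding cell_boundary_class_def Let_def
  using skeletal_relboundary_hom cell_class_carrier by (rule hom_in_carrier)

text \<open>Justifies the definite description in \<open>incidence\<close>: coordinates exist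
  because the cell classes generate, and are unique because each one can be read off in a cell
  group.\<close>

lemma incidence_props:
  assumes s: "s \<in> cells K"
  defines "F \<equiv> {t \<in> cells K. Suc (cell_dim K t) = cell_dim K s}"
    and "G \<equiv> skeletal_homology K (int (cell_dim K s) - 1)"
  shows "(\<forall>t. t \<notin> F \<longrightarrow> incidence K s t = 0) \<and>
    cell_boundary_class K s = finprod G (\<lambda>t. cell_class K t [^]\<^bsub>G\<^esub> incidence K s t) F"
proof -
  let ?P = "\<lambda>a :: 'a set \<Rightarrow> int. (\<forall>t. t \<notin> F \<longrightarrow> a t = 0) \<and>
      cell_boundary_class K s = finprod G (\<lambda>t. cell_class K t [^]\<^bsub>G\<^esub> a t) F"
  interpret G: comm_group G
    unfolding G_def by (rule comm_group_skeletal_homology)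
  have carrier: "cell_boundary_class K s \<in> carrier G"
    unfolding G_def by (rule cell_boundary_class_carrier)
  have "\<exists>!a. ?P a"
  proof (cases "cell_dim K s")
    case 0
    \<comment> \<open>The boundary of a vertex lives in degree \<open>-1\<close>, where the group is
      trivial and there are no cells; the zero function is the only candidate.\<close>
    then have "trivial_group G"
      by (simp add: G_def skeletal_homology_def)
    moreover have "F = {}"
      using 0 by (simp add: F_def)
    ultimately show ?thesis
      using carrier by (auto simp: trivial_group_def fun_eq_iff)
  next
    case (Suc n)
    have F: "F = {t \<in> cells K. cell_dim K t = n}" and G: "G = skeletal_homology K (int n)"
      by (auto simp: F_def G_def Suc)
    have class_carrier: "cell_class K t \<in> carrier G" if "t \<in> F" for t
      using that cell_class_carrier[of t] by (simp add: F G)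
    obtain a :: "'a set \<Rightarrow> int" where a: "cell_boundary_class K s = finprod G (\<lambda>t. cell_class K t [^]\<^bsub>G\<^esub> a t) F"
      using cell_class_generate carrier unfolding G F by blast
    \<comment> \<open>The description requires exponents \<open>0\<close> outside \<open>F\<close>;
      changing them there does not affect the product.\<close>
    have "finprod G (\<lambda>t. cell_class K t [^]\<^bsub>G\<^esub> a t) F
        = finprod G (\<lambda>t. cell_class K t [^]\<^bsub>G\<^esub> (if t \<in> F then a t else 0)) F"
      using class_carrier by (intro G.finprod_cong') auto
    then have ex: "?P (\<lambda>t. if t \<in> F then a t else 0)"
      using a by simp
    have unique: "b = c" if "?P b" "?P c" for b c
    proof
      fix t
      show "b t = c t"
      proof (cases "t \<in> F")
        case True
        then have t: "t \<in> cells K" "cell_dim K t = n"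
          by (auto simp: F)
        interpret H: comm_group "cell_group t"
          by (rule comm_group_cell_group)
        define w where "w = cell_proj t (cell_class K t)"
        have w: "w \<in> carrier (cell_group t)"
          using cell_proj_hom cell_class_carrier unfolding w_def by (metis hom_in_carrier)
        have "w [^]\<^bsub>cell_group t\<^esub> b t = w [^]\<^bsub>cell_group t\<^esub> c t"
          using cell_proj_finprod[OF t(1), of b] cell_proj_finprod[OF t(1), of c] that
          by (simp add: t(2) w_def flip: F G)
        then have "w [^]\<^bsub>cell_group t\<^esub> (b t - c t) = \<one>\<^bsub>cell_group t\<^esub>"
          using w by (simp add: H.int_pow_diff)
        then show ?thesis
          using cell_proj_cell_class_pow[OF t(1), of "b t - c t"] by (simp add: w_def)
      qed (use that in auto)
    qed
    show ?thesis
      using ex unique[OF _ ex] by (rule ex1I)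
  qed
  then have "?P (THE a. ?P a)"
    by (rule theI')
  moreover have "incidence K s = (THE a. ?P a)"
    by (simp add: incidence_def F_def G_def Let_def)
  ultimately show ?thesis
    by simp
qed

lemma incidence_zero:
  "s \<in> cells K \<Longrightarrow> t \<notin> cells K \<or> Suc (cell_dim K t) \<noteq> cell_dim K s \<Longrightarrow> incidence K s t = 0"
  using incidence_props by blast

lemma cell_proj_boundary:
  assumes "s \<in> cells K" "t \<in> cells K" "Suc (cell_dim K t) = cell_dim K s"
  shows "cell_proj t (cell_boundary_class K s) = cell_proj t (cell_class K t) [^]\<^bsub>cell_group t\<^esub> incidence K s t"
proof -
  have "int (cell_dim K s) - 1 = int (cell_dim K t)"
    using assms(3) by linarith
  moreover have "{u \<in> cells K. Suc (cell_dim K u) = cell_dim K s} = {u \<in> cells K. cell_dim K u = cell_dim K t}"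
    using assms(3) by auto
  ultimately show ?thesis
    using cell_proj_finprod[OF assms(2), of "incidence K s"] incidence_props[OF assms(1)] by simp
qed

text \<open>Let \<open>h\<close> be the boundary followed by the coordinate at \<open>u\<close>.
  Applied to the boundary class of \<open>s\<close>, it gives a power of an element of infinite
  order whose exponent is the sum, and it also gives the neutral element, as two successive
  boundaries cancel.\<close>

lemma incidence_squared:
  assumes s: "s \<in> cells K"
  shows "(\<Sum>t\<in>cells K. incidence K s t * incidence K t u) = 0"
proof (cases "u \<in> cells K \<and> Suc (Suc (cell_dim K u)) = cell_dim K s")
  case False
  then have "incidence K s t * incidence K t u = 0" if "t \<in> cells K" for t
    using incidence_zero[OF s, of t] incidence_zero[OF that, of u] by force
  then show ?thesis
    by simp
next
  case True
  then have u: "u \<in> cells K" and dim: "Suc (Suc (cell_dim K u)) = cell_dim K s"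
    by auto
  define m where "m = cell_dim K u"
  define F where "F = {t \<in> cells K. cell_dim K t = Suc m}"
  define G where "G = skeletal_homology K (int (Suc m))"
  define X where "X = subtopology (space K) (skeleton K (int (Suc m)))"
  define h where "h = cell_proj u \<circ> hom_relboundary (int (Suc m)) X (skeleton K (int m)) (skeleton K (int m - 1))"
  have sub: "subtopology X (skeleton K (int m)) = subtopology (space K) (skeleton K (int m))"
    using skeleton_mono[of "int m" "int (Suc m)" K] by (simp add: X_def subtopology_subtopology Int_absorb1)
  have "int (Suc m) - 1 = int m" "int (Suc m) - 2 = int m - 1"
    by auto
  then have "hom_relboundary (int (Suc m)) X (skeleton K (int m)) (skeleton K (int m - 1))
      \<in> hom G (skeletal_homology K (int m))"
    unfolding G_def X_def by (metis skeletal_relboundary_hom)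
  then have h: "h \<in> hom G (cell_group u)"
    unfolding h_def using cell_proj_hom[of u] by (auto simp: m_def intro: hom_compose)
  define w where "w = cell_proj u (cell_class K u)"
  have w: "w \<in> carrier (cell_group u)"
    using cell_proj_hom cell_class_carrier unfolding w_def by (metis hom_in_carrier)
  have F: "finite F"
    using finite_cells by (simp add: F_def)
  have class_carrier: "cell_class K t \<in> carrier G" if "t \<in> F" for t
    using that cell_class_carrier[of t] by (simp add: F_def G_def)
  have hF: "h (cell_class K t) = w [^]\<^bsub>cell_group u\<^esub> incidence K t u" if "t \<in> F" for t
  proof -
    have "h (cell_class K t) = cell_proj u (cell_boundary_class K t)"
      using that by (simp add: h_def F_def X_def cell_boundary_class_def Let_def)
    then show ?thesis
      using that u cell_proj_boundary[of t u] by (simp add: F_def w_def m_def)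
  qed
  have "cell_boundary_class K s = finprod G (\<lambda>t. cell_class K t [^]\<^bsub>G\<^esub> incidence K s t) F"
  proof -
    have "F = {t \<in> cells K. Suc (cell_dim K t) = cell_dim K s}" "int (cell_dim K s) - 1 = int (Suc m)"
      using dim by (auto simp: F_def m_def)
    then show ?thesis
      using incidence_props[OF s] by (simp add: G_def)
  qed
  then have "h (cell_boundary_class K s) = w [^]\<^bsub>cell_group u\<^esub> (\<Sum>t\<in>F. incidence K t u * incidence K s t)"
    using hom_finprod_int_pow[OF _ comm_group_cell_group h F class_carrier w hF] comm_group_skeletal_homology
    by (simp add: G_def)
  moreover have "h (cell_boundary_class K s) = \<one>\<^bsub>cell_group u\<^esub>"
  proof -
    have "cell_boundary_class K s = hom_relboundary (int (Suc m) + 1)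
        (subtopology (space K) (skeleton K (int (Suc m) + 1))) (skeleton K (int (Suc m))) (skeleton K (int m))
        (cell_class K s)"
      by (simp add: cell_boundary_class_def Let_def m_def flip: dim)
    moreover have "subtopology (subtopology (space K) (skeleton K (int (Suc m) + 1))) (skeleton K (int (Suc m))) = X"
      using skeleton_mono[of "int (Suc m)" "int (Suc m) + 1" K] by (simp add: X_def subtopology_subtopology Int_absorb1)
    ultimately have "hom_relboundary (int (Suc m)) X (skeleton K (int m)) (skeleton K (int m - 1)) (cell_boundary_class K s)
        = \<one>\<^bsub>skeletal_homology K (int m)\<^esub>"
      using hom_relboundary_relboundary[of "int (Suc m) + 1" "subtopology (space K) (skeleton K (int (Suc m) + 1))"
          "skeleton K (int (Suc m))" "skeleton K (int m)" "skeleton K (int m - 1)" "cell_class K s"]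
      by (simp add: skeletal_homology_def sub subtopology_skeleton)
    then show ?thesis
      using hom_one[OF cell_proj_hom[of u]] comm_group_skeletal_homology comm_group_cell_group
      by (simp add: h_def m_def comm_group.axioms(2))
  qed
  ultimately have "(\<Sum>t\<in>F. incidence K t u * incidence K s t) = 0"
    using cell_proj_cell_class_pow[OF u] unfolding w_def by metis
  moreover have "incidence K s t = 0" if "t \<in> cells K - F" for t
    by (rule incidence_zero[OF s]) (use that dim in \<open>auto simp: F_def m_def\<close>)
  then have "(\<Sum>t\<in>cells K. incidence K s t * incidence K t u) = (\<Sum>t\<in>F. incidence K s t * incidence K t u)"
    using finite_cells by (intro sum.mono_neutral_right) (auto simp: F_def)
  ultimately show ?thesis
    by (simp add: mult.commute)
qed

text \<open>A point of the sphere is the limit of the interior points \<open>r * x\<close> as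
  \<open>r\<close> tends to \<open>1\<close>, and the preimage of the closure is closed.\<close>

lemma sphere_subset_closure_cell:
  assumes s: "s \<in> cells K"
  shows "char_map K s ` std_sphere (cell_dim K s) \<subseteq> space K closure_of s"
proof clarify
  fix x assume x: "x \<in> std_sphere (cell_dim K s)"
  let ?D = "std_disc (cell_dim K s)"
  define P where "P = {y \<in> topspace ?D. char_map K s y \<in> space K closure_of s}"
  have "closedin ?D P"
    unfolding P_def by (rule closedin_continuous_map_preimage[OF continuous_char_map[OF s]]) simp
  then have "closed P"
    using closed_std_disc by (metis closedin_closed_trans std_disc_eq_top_of_set)
  moreover have "(\<lambda>i. r * x i) \<in> P" if r: "0 \<le> r" "r < 1" for r
  proof -
    have "(\<Sum>i<cell_dim K s. (r * x i)\<^sup>2) = r\<^sup>2 * (\<Sum>i<cell_dim K s. (x i)\<^sup>2)"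
      by (simp add: power_mult_distrib sum_distrib_left)
    also have "\<dots> < 1"
      using x r by (simp add: std_sphere_def power2_eq_square mult_strict_mono[of r 1 r 1, simplified])
    finally have "(\<lambda>i. r * x i) \<in> std_open_disc (cell_dim K s)"
      using x by (simp add: std_open_disc_def std_sphere_def topspace_std_disc)
    moreover from this have "char_map K s (\<lambda>i. r * x i) \<in> s"
      using bij_char_map[OF s] unfolding bij_betw_def by blast
    ultimately show ?thesis
      using std_open_disc_subset closure_of_subset[OF cell_subset_topspace[OF s]]
      unfolding P_def by blast
  qed
  ultimately have "(\<lambda>(r::real) i. r * x i) ` closure {0..<1} \<subseteq> P"
    by (intro image_closure_subset continuous_on_coordinatewise_then_product continuous_intros) auto
  moreover have "(\<lambda>i. 1 * x i) \<in> (\<lambda>(r::real) i. r * x i) ` closure {0..<1}"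
    by (rule image_eqI[where x = 1]) auto
  ultimately have "(\<lambda>i. 1 * x i) \<in> P"
    by blast
  then show "char_map K s x \<in> space K closure_of s"
    by (simp add: P_def)
qed

lemma incidence_imp_subset_closure:
  assumes s: "s \<in> cells K" and nz: "incidence K s t \<noteq> 0"
  shows "t \<subseteq> space K closure_of s"
proof (rule ccontr)
  assume "\<not> t \<subseteq> space K closure_of s"
  then obtain c where c: "c \<in> t" "c \<notin> space K closure_of s"
    by blast
  have t: "t \<in> cells K" and dim: "cell_dim K s = Suc (cell_dim K t)"
    using incidence_zero[OF s, of t] nz by metis+
  define m where "m = cell_dim K t"
  define n where "n = Suc m"
  define Y where "Y = subtopology (space K) (skeleton K (int n))"
  define X where "X = subtopology (space K) (skeleton K (int m))"
  define A where "A = skeleton K (int m) - t"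
  define \<Phi> where "\<Phi> = char_map K s"
  interpret cell_attachment X A m "char_map K t"
    unfolding X_def A_def skeleton_eq_Union m_def using t
    by (intro cell_attachment_cell) (auto simp: cells_upto_def)
  have "c \<in> char_map K t ` std_open_disc m"
    using bij_betw_imp_surj_on[OF finite_cw.bij_char_map[OF finite_cw_axioms t]] c(1) by (simp add: m_def)
  then obtain d where d: "d \<in> std_open_disc m" "char_map K t d = c"
    by blast
  \<comment> \<open>Only the point \<open>c\<close> is known to avoid the closure of
    \<open>s\<close>, so the skeleton is punctured at \<open>c\<close>;
    \<open>iso_homology_puncture\<close> makes this as good as removing all of
    \<open>t\<close>.\<close>
  define X' where "X' = topspace X - {c}"
  have iso: "hom_induced (int m) X A X X' id
      \<in> iso (cell_group t) (relative_homology_group (int m) X X')"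
    using iso_homology_puncture[OF d(1), of "int m"]
    by (simp add: X'_def d(2) cell_group_def A_def X_def m_def Let_def)
  have A: "A \<subseteq> X'"
    using closedin_subset[OF closedin_A] c(1) by (auto simp: X'_def A_def)
  have lower: "skeleton K (int m - 1) \<subseteq> A"
    unfolding A_def m_def by (rule skeleton_Diff_cell[OF t])
  have sub: "subtopology Y (skeleton K (int m)) = X"
    using skeleton_mono[of "int m" "int n" K] by (simp add: X_def Y_def n_def subtopology_subtopology Int_absorb1)
  have cont: "continuous_map (std_disc n) Y \<Phi>" and sphere: "\<Phi> ` std_sphere n \<subseteq> skeleton K (int m)"
    using char_map_skeleton(1)[OF s] finite_cw.char_map_sphere[OF finite_cw_axioms s]
    by (simp_all add: dim Y_def \<Phi>_def n_def m_def)
  have cont_sphere: "continuous_map (subtopology (std_disc n) (std_sphere n)) X \<Phi>"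
    unfolding sub[symmetric] using cont sphere
    by (auto simp: continuous_map_in_subtopology continuous_map_from_subtopology)
  \<comment> \<open>By naturality of the connecting homomorphism, the boundary of \<open>s\<close>
    is the image of \<open>b\<close>, a class living on the sphere.\<close>
  define b where "b = hom_boundary (int n) (std_disc n) (std_sphere n) (orientation K s)"
  have "hom_boundary (int n) Y (skeleton K (int m)) (cell_class K s)
      = hom_induced (int m) (subtopology (std_disc n) (std_sphere n)) {} X {} \<Phi> b"
    using fun_cong[OF naturality_hom_induced[OF cont, of "std_sphere n" "skeleton K (int m)" "int n"], of "orientation K s"]
      sphere
    by (simp add: cell_class_def Let_def dim Y_def \<Phi>_def n_def m_def b_def image_subset_iff_funcset
        flip: X_def sub[unfolded Y_def n_def m_def])
  then have "cell_boundary_class K s = hom_induced (int m) X {} X (skeleton K (int m - 1)) id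
      (hom_induced (int m) (subtopology (std_disc n) (std_sphere n)) {} X {} \<Phi> b)"
    using sub by (simp add: cell_boundary_class_def Let_def dim hom_relboundary_def m_def n_def Y_def)
  then have "hom_induced (int m) X A X X' id (cell_proj t (cell_boundary_class K s))
      = hom_induced (int m) (subtopology (std_disc n) (std_sphere n)) {} X X' \<Phi> b"
  proof -
    have "hom_induced (int m) X A X X' id (hom_induced (int m) X (skeleton K (int m - 1)) X A id y)
        = hom_induced (int m) X (skeleton K (int m - 1)) X X' (id \<circ> id) y" for y
      using A lower by (intro hom_induced_compose') auto
    moreover have "hom_induced (int m) X (skeleton K (int m - 1)) X X' id
        (hom_induced (int m) X {} X (skeleton K (int m - 1)) id y)
        = hom_induced (int m) X {} X X' (id \<circ> id) y" for y
      using A lower by (intro hom_induced_compose') auto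
    moreover have "hom_induced (int m) X {} X X' id
        (hom_induced (int m) (subtopology (std_disc n) (std_sphere n)) {} X {} \<Phi> b)
        = hom_induced (int m) (subtopology (std_disc n) (std_sphere n)) {} X X' (id \<circ> \<Phi>) b"
      using cont_sphere by (intro hom_induced_compose') auto
    ultimately show ?thesis
      using \<open>cell_boundary_class K s = _\<close>
      by (simp add: cell_proj_def Let_def flip: m_def X_def A_def)
  qed
  \<comment> \<open>The sphere maps into the closure of \<open>s\<close>, which misses
    \<open>c\<close>.\<close>
  also have "\<dots> = \<one>\<^bsub>relative_homology_group (int m) X X'\<^esub>"
  proof (rule hom_induced_into_subset)
    have "\<Phi> ` std_sphere n \<subseteq> space K closure_of s"
      using sphere_subset_closure_cell[OF s] by (simp add: \<Phi>_def n_def m_def flip: dim)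
    then show "\<Phi> ` topspace (subtopology (std_disc n) (std_sphere n)) \<subseteq> X'"
      using c(2) continuous_map_image_subset_topspace[OF cont_sphere] by (auto simp: X'_def)
  qed (use cont_sphere in auto)
  finally have "cell_proj t (cell_boundary_class K s) = \<one>\<^bsub>cell_group t\<^esub>"
  proof -
    assume eq: "hom_induced (int m) X A X X' id (cell_proj t (cell_boundary_class K s))
      = \<one>\<^bsub>relative_homology_group (int m) X X'\<^esub>"
    interpret h: group_hom "cell_group t" "relative_homology_group (int m) X X'" "hom_induced (int m) X A X X' id"
      using iso comm_group_cell_group[of t]
      by (simp add: group_hom_def group_hom_axioms_def iso_def comm_group.axioms(2))
    have "cell_proj t (cell_boundary_class K s) \<in> carrier (cell_group t)"
      by (simp add: cell_proj_def cell_group_def Let_def hom_induced_carrier)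
    then show ?thesis
      using eq iso h.hom_one h.G.one_closed
      by (auto simp: iso_def bij_betw_def inj_on_def)
  qed
  then have "cell_proj t (cell_class K t) [^]\<^bsub>cell_group t\<^esub> incidence K s t = \<one>\<^bsub>cell_group t\<^esub>"
    using cell_proj_boundary[OF s t] dim by simp
  then show False
    using cell_proj_cell_class_pow[OF t] nz by simp
qed

end


section \<open>Quotients of function spaces\<close>

text \<open>Has the same undefined multiplicative fields as \<open>cellular_chains\<close>, so that
  the module of cycles is literally of this form.\<close>

definition function_module :: "('b \<Rightarrow> 'k::field) set \<Rightarrow> ('k, 'b \<Rightarrow> 'k) module" where
  "function_module Z = \<lparr> carrier = Z, mult = undefined, one = undefined,
     zero = (\<lambda>s. 0), add = (\<lambda>c d s. c s + d s), smult = (\<lambda>a c s. a * c s) \<rparr>"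

definition function_subspace :: "('b \<Rightarrow> 'k::field) set \<Rightarrow> bool" where
  "function_subspace Z \<longleftrightarrow> (\<lambda>s. 0) \<in> Z \<and> (\<forall>x\<in>Z. \<forall>y\<in>Z. (\<lambda>s. x s + y s) \<in> Z) \<and>
     (\<forall>a. \<forall>x\<in>Z. (\<lambda>s. a * x s) \<in> Z)"

lemma function_subspaceD:
  assumes "function_subspace Z"
  shows "(\<lambda>s. 0) \<in> Z"
    and "x \<in> Z \<Longrightarrow> y \<in> Z \<Longrightarrow> (\<lambda>s. x s + y s) \<in> Z"
    and "x \<in> Z \<Longrightarrow> (\<lambda>s. a * x s) \<in> Z"
  using assms by (auto simp: function_subspace_def)

lemma function_subspace_diff:
  assumes "function_subspace Z" "x \<in> Z" "y \<in> Z"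
  shows "(\<lambda>s. x s - y s) \<in> Z"
  using function_subspaceD(2)[OF assms(1,2) function_subspaceD(3)[OF assms(1,3), of "-1"]] by simp

locale function_quotient =
  fixes Z B :: "('b \<Rightarrow> 'k::field) set"
  assumes Z: "function_subspace Z" and B: "function_subspace B" and B_subset: "B \<subseteq> Z"
begin

abbreviation coset :: "('b \<Rightarrow> 'k) \<Rightarrow> ('b \<Rightarrow> 'k) set" where
  "coset c \<equiv> B +>\<^bsub>function_module Z\<^esub> c"

abbreviation Q :: "('k, ('b \<Rightarrow> 'k) set) module" where
  "Q \<equiv> quotient_module (function_module Z) B"

lemma coset_eq: "coset c = (\<lambda>b s. b s + c s) ` B"
  by (auto simp: a_r_coset_def' function_module_def)

lemma mem_coset: "x \<in> coset c \<longleftrightarrow> (\<lambda>s. x s - c s) \<in> B"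
proof
  assume "(\<lambda>s. x s - c s) \<in> B"
  then show "x \<in> coset c"
    unfolding coset_eq by (rule image_eqI[rotated]) simp
qed (auto simp: coset_eq)

lemma coset_eq_iff: "coset c = coset d \<longleftrightarrow> (\<lambda>s. c s - d s) \<in> B"
proof
  assume "coset c = coset d"
  moreover have "c \<in> coset c"
    using function_subspaceD(1)[OF B] by (simp add: mem_coset)
  ultimately show "(\<lambda>s. c s - d s) \<in> B"
    by (simp add: mem_coset)
next
  assume cd: "(\<lambda>s. c s - d s) \<in> B"
  have "(\<lambda>s. x s - c s) \<in> B \<longleftrightarrow> (\<lambda>s. x s - d s) \<in> B" for x
    using function_subspaceD(2)[OF B _ cd, of "\<lambda>s. x s - c s"]
      function_subspace_diff[OF B _ cd, of "\<lambda>s. x s - d s"] by auto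
  then show "coset c = coset d"
    by (auto simp: mem_coset)
qed

lemma carrier_Q: "carrier Q = coset ` Z"
  by (auto simp: quotient_module_def A_RCOSETS_def' function_module_def)

lemma zero_Q: "\<zero>\<^bsub>Q\<^esub> = coset (\<lambda>s. 0)"
  by (auto simp: quotient_module_def mem_coset)

lemma add_Q_eq: "X \<oplus>\<^bsub>Q\<^esub> Y = (\<Union>x\<in>X. \<Union>y\<in>Y. {\<lambda>s. x s + y s})"
  by (simp add: quotient_module_def set_add_def' function_module_def)

lemma add_Q: "coset c \<oplus>\<^bsub>Q\<^esub> coset d = coset (\<lambda>s. c s + d s)"
proof (intro equalityI subsetI)
  fix x assume "x \<in> coset c \<oplus>\<^bsub>Q\<^esub> coset d"
  then obtain y z where yz: "y \<in> coset c" "z \<in> coset d" "x = (\<lambda>s. y s + z s)"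
    unfolding add_Q_eq by blast
  then have "(\<lambda>s. (y s - c s) + (z s - d s)) \<in> B"
    using function_subspaceD(2)[OF B] by (simp add: mem_coset)
  then show "x \<in> coset (\<lambda>s. c s + d s)"
    by (simp add: yz(3) mem_coset algebra_simps)
next
  fix x assume "x \<in> coset (\<lambda>s. c s + d s)"
  then have "(\<lambda>s. x s - d s) \<in> coset c" "d \<in> coset d"
    using function_subspaceD(1)[OF B] by (simp_all add: mem_coset algebra_simps)
  moreover have "x = (\<lambda>s. (x s - d s) + d s)"
    by simp
  ultimately show "x \<in> coset c \<oplus>\<^bsub>Q\<^esub> coset d"
    unfolding add_Q_eq by (intro UN_I) auto
qed

text \<open>The union over all representatives collapses, since each of them yields the same
  coset.\<close>

lemma smult_Q: "a \<odot>\<^bsub>Q\<^esub> coset c = coset (\<lambda>s. a * c s)"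
proof -
  have "coset (\<lambda>s. a * x s) = coset (\<lambda>s. a * c s)" if "x \<in> coset c" for x
    using function_subspaceD(3)[OF B, of "\<lambda>s. x s - c s" a] that
    by (simp add: coset_eq_iff mem_coset right_diff_distrib)
  moreover have "c \<in> coset c"
    using function_subspaceD(1)[OF B] by (simp add: mem_coset)
  ultimately have "(\<Union>x\<in>coset c. coset (\<lambda>s. a * x s)) = coset (\<lambda>s. a * c s)"
    by blast
  then show ?thesis
    by (simp add: quotient_module_def) (simp add: function_module_def)
qed

lemma vectorspace_Q: "vectorspace class_ring Q"
proof -
  note simps = carrier_Q zero_Q add_Q smult_Q
  have "abelian_group Q"
  proof (rule abelian_groupI)
    show "\<exists>y\<in>carrier Q. y \<oplus>\<^bsub>Q\<^esub> x = \<zero>\<^bsub>Q\<^esub>" if "x \<in> carrier Q" for x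
    proof -
      obtain c where c: "c \<in> Z" "x = coset c"
        using \<open>x \<in> carrier Q\<close> by (auto simp: carrier_Q)
      then have "coset (\<lambda>s. -1 * c s) \<oplus>\<^bsub>Q\<^esub> x = \<zero>\<^bsub>Q\<^esub>"
        by (simp only: simps) simp
      then show ?thesis
        using function_subspaceD(3)[OF Z c(1), of "-1"] unfolding carrier_Q by blast
    qed
    show "\<zero>\<^bsub>Q\<^esub> \<in> carrier Q"
      using function_subspaceD(1)[OF Z] by (simp add: simps)
    show "x \<oplus>\<^bsub>Q\<^esub> y \<in> carrier Q" if "x \<in> carrier Q" "y \<in> carrier Q" for x y
      using that function_subspaceD(2)[OF Z] by (auto simp: simps)
  qed (auto simp: simps algebra_simps)
  then have "module class_ring Q"
  proof (rule moduleI[OF class_cring.is_cring])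
    show "a \<odot>\<^bsub>Q\<^esub> x \<in> carrier Q" if "x \<in> carrier Q" for a x
      using that function_subspaceD(3)[OF Z] by (auto simp: simps)
  qed (auto simp: simps algebra_simps)
  then show ?thesis
    by (simp add: vectorspace_def class_field)
qed

text \<open>Turns statements about indexed sums modulo \<open>B\<close> into a basis of the
  quotient. Injectivity comes first, because linear combinations over the set of classes must be
  reindexed by \<open>I\<close>.\<close>

lemma basis_Q:
  assumes I: "finite I" and z: "\<And>i. i \<in> I \<Longrightarrow> z i \<in> Z"
    and span: "\<And>c. c \<in> Z \<Longrightarrow> \<exists>a. (\<lambda>s. c s - (\<Sum>i\<in>I. a i * z i s)) \<in> B"
    and indep: "\<And>a i. (\<lambda>s. \<Sum>i\<in>I. a i * z i s) \<in> B \<Longrightarrow> i \<in> I \<Longrightarrow> a i = 0"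
  shows "inj_on (\<lambda>i. coset (z i)) I" and "vectorspace.basis class_ring Q ((\<lambda>i. coset (z i)) ` I)"
proof -
  let ?cls = "\<lambda>i. coset (z i)"
  interpret vectorspace class_ring Q
    by (rule vectorspace_Q)
  show inj: "inj_on ?cls I"
  proof (rule inj_onI, rule ccontr)
    fix i j assume ij: "i \<in> I" "j \<in> I" "?cls i = ?cls j" "i \<noteq> j"
    \<comment> \<open>Coefficients of \<open>z i - z j\<close>; equal classes would make this a
      relation with coefficient \<open>1\<close> at \<open>i\<close>.\<close>
    define a where "a = (\<lambda>l. if l = i then 1 else if l = j then -1 else 0 :: 'k)"
    have "(\<Sum>l\<in>I. a l * z l s) = z i s - z j s" for s
    proof -
      have "(\<Sum>l\<in>I. a l * z l s) = (\<Sum>l\<in>{i, j}. a l * z l s)"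
        using I ij by (intro sum.mono_neutral_right) (auto simp: a_def)
      then show ?thesis
        using ij by (simp add: a_def)
    qed
    then have "a i = 0"
      using ij by (intro indep) (simp_all add: coset_eq_iff)
    then show False
      by (simp add: a_def)
  qed
  have sub: "?cls ` I \<subseteq> carrier Q"
    using z by (auto simp: carrier_Q)
  have lincomb: "lincomb a (?cls ` I) = coset (\<lambda>s. \<Sum>i\<in>I. a (?cls i) * z i s)" for a
  proof -
    have "(\<Oplus>\<^bsub>Q\<^esub>i\<in>J. a (?cls i) \<odot>\<^bsub>Q\<^esub> ?cls i) = coset (\<lambda>s. \<Sum>i\<in>J. a (?cls i) * z i s)" if "J \<subseteq> I" for J
      using finite_subset[OF that I] that
    proof (induction J rule: finite_induct)
      case empty
      then show ?case
        by (simp add: zero_Q)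
    next
      case (insert i J)
      then have "a (?cls l) \<odot>\<^bsub>Q\<^esub> ?cls l \<in> carrier Q" if "l \<in> insert i J" for l
        using sub that by (intro smult_closed) auto
      then have "(\<Oplus>\<^bsub>Q\<^esub>i\<in>insert i J. a (?cls i) \<odot>\<^bsub>Q\<^esub> ?cls i)
          = a (?cls i) \<odot>\<^bsub>Q\<^esub> ?cls i \<oplus>\<^bsub>Q\<^esub> (\<Oplus>\<^bsub>Q\<^esub>i\<in>J. a (?cls i) \<odot>\<^bsub>Q\<^esub> ?cls i)"
        using insert.hyps by (intro M.finsum_insert) auto
      then show ?case
        using insert by (simp add: smult_Q add_Q)
    qed
    from this[of I] show ?thesis
      using inj sub by (simp add: lincomb_def M.finsum_reindex Pi_iff image_subset_iff)
  qed
  have "lin_indpt (?cls ` I)"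
  proof (rule finite_lin_indpt2[OF finite_imageI[OF I] sub])
    fix a :: "('b \<Rightarrow> 'k) set \<Rightarrow> 'k"
    assume "lincomb a (?cls ` I) = \<zero>\<^bsub>Q\<^esub>"
    then have "(\<lambda>s. \<Sum>i\<in>I. a (?cls i) * z i s) \<in> B"
      by (simp add: lincomb zero_Q coset_eq_iff)
    then show "\<forall>v\<in>?cls ` I. a v = \<zero>\<^bsub>class_ring\<^esub>"
      using indep by auto
  qed
  moreover have "carrier Q \<subseteq> LinearCombinations.module.span class_ring Q (?cls ` I)"
  proof
    fix x assume "x \<in> carrier Q"
    then obtain c where c: "c \<in> Z" "x = coset c"
      by (auto simp: carrier_Q)
    obtain a where a: "(\<lambda>s. c s - (\<Sum>i\<in>I. a i * z i s)) \<in> B"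
      using span[OF c(1)] by blast
    \<comment> \<open>Coefficients are carried from indices to classes, which is well defined by
      injectivity.\<close>
    define a' where "a' = (\<lambda>v. a (inv_into I ?cls v))"
    have "a' (?cls i) = a i" if "i \<in> I" for i
      using inv_into_f_f[OF inj that] by (simp add: a'_def)
    then have "lincomb a' (?cls ` I) = coset (\<lambda>s. \<Sum>i\<in>I. a i * z i s)"
      by (simp add: lincomb)
    also have "\<dots> = x"
      using a c(2) coset_eq_iff[of c "\<lambda>s. \<Sum>i\<in>I. a i * z i s"] by simp
    finally show "x \<in> span (?cls ` I)"
      using I by (force simp: span_def)
  qed
  ultimately show "basis (?cls ` I)"
    using sub span_is_subset2[OF sub] by (auto simp: basis_def)
qed

end


section \<open>Column reduction\<close>

lemma sum_nonzero_imp: "sum g A \<noteq> 0 \<Longrightarrow> \<exists>a\<in>A. g a \<noteq> 0"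
  using sum.neutral by metis

locale cw_reduction = finite_cw K for K :: "'a cw_complex" +
  fixes f :: "'a set \<Rightarrow> real" and \<sigma> :: "nat \<Rightarrow> 'a set" and N :: nat
    and R V :: "nat \<Rightarrow> nat \<Rightarrow> 'k::field"
  assumes order: "compatible_order K f N \<sigma>" and reduction: "reduction K N \<sigma> R V"
begin

lemma bij_order: "bij_betw \<sigma> {1..N} (cells K)"
  using order by (simp add: compatible_order_def)

lemma cell_in: "i \<in> {1..N} \<Longrightarrow> \<sigma> i \<in> cells K"
  using bij_order by (auto simp: bij_betw_def)

lemma cell_index: "t \<in> cells K \<Longrightarrow> \<exists>r\<in>{1..N}. t = \<sigma> r"
  using bij_betw_imp_surj_on[OF bij_order] by blast

lemma order_eq_iff: "i \<in> {1..N} \<Longrightarrow> j \<in> {1..N} \<Longrightarrow> \<sigma> i = \<sigma> j \<longleftrightarrow> i = j"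
  by (rule inj_on_eq_iff[OF bij_betw_imp_inj_on[OF bij_order]])

text \<open>Strict upper triangularity of \<open>D\<close>: a cell with nonzero incidence lies in
  the closure of \<open>\<sigma> j\<close>, and differs from \<open>\<sigma> j\<close> by its
  dimension.\<close>

lemma incidence_order:
  assumes "i \<in> {1..N}" "j \<in> {1..N}" "incidence K (\<sigma> j) (\<sigma> i) \<noteq> 0"
  shows "i < j"
proof -
  have "\<sigma> i \<subseteq> space K closure_of \<sigma> j"
    using incidence_imp_subset_closure[OF cell_in[OF assms(2)] assms(3)] .
  moreover have "\<sigma> i \<noteq> \<sigma> j"
    using incidence_zero[OF cell_in[OF assms(2)], of "\<sigma> j"] assms(3) by auto
  ultimately show ?thesis
    using order assms(1,2) by (auto simp: compatible_order_def)
qed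

lemma incidence_dim:
  assumes "s \<in> cells K" "incidence K s t \<noteq> 0"
  shows "t \<in> cells K" "cell_dim K s = Suc (cell_dim K t)"
  using incidence_zero[OF assms(1), of t] assms(2) by metis+

lemma R_eq: "i \<in> {1..N} \<Longrightarrow> j \<in> {1..N} \<Longrightarrow> R i j = (\<Sum>l = 1..N. of_int (incidence K (\<sigma> l) (\<sigma> i)) * V l j)"
  using reduction by (simp add: reduction_def boundary_matrix_def)

lemma V_diag: "i \<in> {1..N} \<Longrightarrow> V i i = 1"
  and V_upper: "i \<in> {1..N} \<Longrightarrow> j \<in> {1..N} \<Longrightarrow> j < i \<Longrightarrow> V i j = 0"
  and V_dim: "l \<in> {1..N} \<Longrightarrow> i \<in> {1..N} \<Longrightarrow> V l i \<noteq> 0 \<Longrightarrow> cell_dim K (\<sigma> l) = cell_dim K (\<sigma> i)"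
  using reduction unfolding reduction_def upper_unitriangular_def dimension_preserving_def by blast+

lemma low_props:
  assumes "\<not> zero_column N R j"
  shows "low N R j \<in> {1..N}" "R (low N R j) j \<noteq> 0" "i \<in> {1..N} \<Longrightarrow> low N R j < i \<Longrightarrow> R i j = 0"
proof -
  let ?S = "{i \<in> {1..N}. R i j \<noteq> 0}"
  have S: "finite ?S" "?S \<noteq> {}"
    using assms by (auto simp: zero_column_def)
  then have "low N R j \<in> ?S"
    unfolding low_def by (rule Max_in)
  then show "low N R j \<in> {1..N}" "R (low N R j) j \<noteq> 0"
    by auto
  show "R i j = 0" if "i \<in> {1..N}" "low N R j < i"
  proof (rule ccontr)
    assume "R i j \<noteq> 0"
    then have "i \<le> low N R j"
      using that(1) Max_ge[OF S(1), of i] by (simp add: low_def)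
    then show False
      using that(2) by simp
  qed
qed

lemma low_inj:
  "\<lbrakk>i \<in> {1..N}; j \<in> {1..N}; \<not> zero_column N R i; \<not> zero_column N R j; low N R i = low N R j\<rbrakk> \<Longrightarrow> i = j"
  using reduction unfolding reduction_def reduced_def by blast

lemma pair_low:
  assumes "j \<in> {1..N}" "\<not> zero_column N R j"
  shows "pair N R (low N R j) = enat j"
proof -
  have "(THE j'. j' \<in> {1..N} \<and> \<not> zero_column N R j' \<and> low N R j' = low N R j) = j"
    using assms low_inj by (intro the_equality) auto
  then show ?thesis
    using assms by (auto simp: pair_def)
qed

section \<open>Chains of a stage and the columns of \<open>V\<close> and \<open>R\<close>\<close>

definition z :: "nat \<Rightarrow> 'a set \<Rightarrow> 'k" where
  "z i = birth_cycle K \<sigma> V i"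

definition chains :: "nat \<Rightarrow> nat \<Rightarrow> ('a set \<Rightarrow> 'k) set" where
  "chains p q = {c. \<forall>s. c s \<noteq> 0 \<longrightarrow> s \<in> \<sigma> ` {1..p} \<and> cell_dim K s = q}"

abbreviation bd :: "nat \<Rightarrow> ('a set \<Rightarrow> 'k) \<Rightarrow> 'a set \<Rightarrow> 'k" where
  "bd q \<equiv> cellular_boundary K q"

definition cycles :: "nat \<Rightarrow> nat \<Rightarrow> ('a set \<Rightarrow> 'k) set" where
  "cycles p q = {c \<in> chains p q. bd q c = (\<lambda>t. 0)}"

lemma chains_zero: "c \<in> chains p q \<Longrightarrow> s \<notin> \<sigma> ` {1..p} \<or> cell_dim K s \<noteq> q \<Longrightarrow> c s = 0"
  by (auto simp: chains_def)

lemma chains_Suc: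
  assumes "c \<in> chains (Suc p) q" "c (\<sigma> (Suc p)) = 0"
  shows "c \<in> chains p q"
  using assms by (auto simp: chains_def image_iff) (metis atLeastAtMost_iff le_Suc_eq)

lemma function_subspace_chains: "function_subspace (chains p q)"
  unfolding function_subspace_def
proof (intro conjI ballI allI)
  show "(\<lambda>s. 0) \<in> chains p q"
    by (simp add: chains_def)
  fix x a assume x: "x \<in> chains p q"
  show "(\<lambda>s. a * x s) \<in> chains p q"
    using x by (simp add: chains_def)
  fix y assume y: "y \<in> chains p q"
  have "x s \<noteq> 0 \<or> y s \<noteq> 0" if "x s + y s \<noteq> 0" for s
    using that by auto
  then show "(\<lambda>s. x s + y s) \<in> chains p q"
    using x y unfolding chains_def mem_Collect_eq by meson
qed

lemma bd_sum: "bd q (\<lambda>s. \<Sum>i\<in>I. a i * x i s) = (\<lambda>t. \<Sum>i\<in>I. a i * bd q (x i) t)"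
proof
  fix t
  have "bd q (\<lambda>s. \<Sum>i\<in>I. a i * x i s) t
      = (\<Sum>s | s \<in> cells K \<and> cell_dim K s = q. \<Sum>i\<in>I. a i * (x i s * of_int (incidence K s t)))"
    by (simp add: cellular_boundary_def sum_distrib_right mult.assoc)
  also have "\<dots> = (\<Sum>i\<in>I. a i * bd q (x i) t)"
    by (subst sum.swap) (simp add: cellular_boundary_def sum_distrib_left)
  finally show "bd q (\<lambda>s. \<Sum>i\<in>I. a i * x i s) t = (\<Sum>i\<in>I. a i * bd q (x i) t)" .
qed

lemma bd_zero: "bd q (\<lambda>s. 0) = (\<lambda>t. 0)"
  by (simp add: cellular_boundary_def)

lemma bd_add: "bd q (\<lambda>s. x s + y s) = (\<lambda>t. bd q x t + bd q y t)"
  by (simp add: cellular_boundary_def distrib_right sum.distrib)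

lemma bd_smult: "bd q (\<lambda>s. a * x s) = (\<lambda>t. a * bd q x t)"
  by (simp add: cellular_boundary_def sum_distrib_left mult.assoc)

text \<open>After exchanging the sums, the inner one is that of \<open>incidence_squared\<close>,
  because cells outside dimension \<open>q\<close> have incidence \<open>0\<close> with
  \<open>s\<close>.\<close>

lemma bd_bd: "bd q (bd (Suc q) c) = (\<lambda>t. 0)"
proof
  fix u
  have "bd q (bd (Suc q) c) u = (\<Sum>t | t \<in> cells K \<and> cell_dim K t = q. \<Sum>s | s \<in> cells K \<and> cell_dim K s = Suc q.
      c s * of_int (incidence K s t * incidence K t u))"
    by (simp add: cellular_boundary_def sum_distrib_right mult.assoc)
  also have "\<dots> = (\<Sum>s | s \<in> cells K \<and> cell_dim K s = Suc q. c s *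
      of_int (\<Sum>t | t \<in> cells K \<and> cell_dim K t = q. incidence K s t * incidence K t u))"
    by (subst sum.swap) (simp add: sum_distrib_left)
  also have "\<dots> = 0"
  proof (intro sum.neutral ballI)
    fix s assume s: "s \<in> {s. s \<in> cells K \<and> cell_dim K s = Suc q}"
    have "(\<Sum>t | t \<in> cells K \<and> cell_dim K t = q. incidence K s t * incidence K t u)
        = (\<Sum>t\<in>cells K. incidence K s t * incidence K t u)"
      using s finite_cells incidence_dim(2)[of s] by (intro sum.mono_neutral_left) auto
    then show "c s * of_int (\<Sum>t | t \<in> cells K \<and> cell_dim K t = q. incidence K s t * incidence K t u) = 0"
      using s incidence_squared[of s u] by simp
  qed
  finally show "bd q (bd (Suc q) c) u = 0" .
qed

text \<open>Each stage behaves as a subcomplex, since by \<open>incidence_order\<close> the cells in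
  a boundary come before the cell they bound.\<close>

lemma bd_chains:
  assumes c: "c \<in> chains p (Suc q)" and p: "p \<le> N"
  shows "bd (Suc q) c \<in> chains p q"
proof -
  have "t \<in> \<sigma> ` {1..p} \<and> cell_dim K t = q" if nz: "bd (Suc q) c t \<noteq> 0" for t
  proof -
    obtain s where s: "s \<in> cells K" "cell_dim K s = Suc q" "c s * of_int (incidence K s t) \<noteq> 0"
      using sum_nonzero_imp[OF nz[unfolded cellular_boundary_def]] by auto
    then have inc: "incidence K s t \<noteq> 0" "c s \<noteq> 0"
      by auto
    then obtain j where j: "j \<in> {1..p}" "s = \<sigma> j"
      using c by (auto simp: chains_def)
    have t: "t \<in> cells K" "cell_dim K t = q"
      using incidence_dim[OF s(1) inc(1)] s(2) by auto
    then obtain i where i: "i \<in> {1..N}" "t = \<sigma> i"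
      using cell_index by blast
    then have "i < j"
      using incidence_order[of i j] inc(1) j p by auto
    then show ?thesis
      using i j t by auto
  qed
  then show ?thesis
    by (auto simp: chains_def)
qed

text \<open>The restricted range of the sum loses nothing: \<open>V\<close> is upper triangular and
  dimension preserving.\<close>

lemma z_cell:
  assumes i: "i \<in> {1..N}" and l: "l \<in> {1..N}"
  shows "z i (\<sigma> l) = V l i"
proof -
  let ?S = "{l \<in> {1..i}. cell_dim K (\<sigma> l) = cell_dim K (\<sigma> i)}"
  have "z i (\<sigma> l) = (\<Sum>l'\<in>?S. if l' = l then V l' i else 0)"
    unfolding z_def birth_cycle_def using i l order_eq_iff by (intro sum.cong) auto
  also have "\<dots> = (if l \<in> ?S then V l i else 0)"
    by simp
  also have "\<dots> = V l i"
    using V_upper[OF l i] V_dim[OF l i] l by (auto simp: not_le)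
  finally show ?thesis .
qed

lemma z_chains:
  assumes "i \<in> {1..N}" "i \<le> p"
  shows "z i \<in> chains p (cell_dim K (\<sigma> i))"
proof -
  have "s \<in> \<sigma> ` {1..p} \<and> cell_dim K s = cell_dim K (\<sigma> i)" if nz: "z i s \<noteq> 0" for s
  proof -
    obtain l where "l \<in> {1..i}" "cell_dim K (\<sigma> l) = cell_dim K (\<sigma> i)" "(if s = \<sigma> l then V l i else 0) \<noteq> 0"
      using sum_nonzero_imp[OF nz[unfolded z_def birth_cycle_def]] by blast
    then show ?thesis
      using assms by (auto split: if_splits)
  qed
  then show ?thesis
    by (auto simp: chains_def)
qed

text \<open>The factorization \<open>R = D V\<close>, read column by column as a boundary of
  chains.\<close>

lemma bd_z:
  assumes i: "i \<in> {1..N}" and r: "r \<in> {1..N}"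
  shows "bd (cell_dim K (\<sigma> i)) (z i) (\<sigma> r) = R r i"
proof -
  have "bd (cell_dim K (\<sigma> i)) (z i) (\<sigma> r) = (\<Sum>s\<in>cells K. z i s * of_int (incidence K s (\<sigma> r)))"
    unfolding cellular_boundary_def using finite_cells chains_zero[OF z_chains[OF i order_refl]]
    by (intro sum.mono_neutral_left) auto
  also have "\<dots> = (\<Sum>l\<in>{1..N}. z i (\<sigma> l) * of_int (incidence K (\<sigma> l) (\<sigma> r)))"
    by (rule sum.reindex_bij_betw[OF bij_order, symmetric])
  also have "\<dots> = R r i"
    using z_cell[OF i] by (simp add: R_eq[OF r i] mult.commute)
  finally show ?thesis .
qed

lemma bd_outside: "t \<notin> cells K \<Longrightarrow> bd q c t = 0"
  using incidence_zero by (force simp: cellular_boundary_def)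

lemma bd_z_zero_column:
  assumes i: "i \<in> {1..N}" "zero_column N R i"
  shows "bd (cell_dim K (\<sigma> i)) (z i) = (\<lambda>t. 0)"
proof
  fix t
  show "bd (cell_dim K (\<sigma> i)) (z i) t = 0"
  proof (cases "t \<in> cells K")
    case True
    then obtain r where "r \<in> {1..N}" "t = \<sigma> r"
      using cell_index by blast
    then show ?thesis
      using bd_z[OF i(1)] i(2) by (simp add: zero_column_def)
  qed (rule bd_outside)
qed

text \<open>Column \<open>j\<close> of \<open>R\<close> is a boundary of cells of the dimension of
  \<open>\<sigma> j\<close>, so every row with a nonzero entry has dimension one less.\<close>

lemma dim_low:
  assumes "j \<in> {1..N}" "\<not> zero_column N R j"
  shows "cell_dim K (\<sigma> j) = Suc (cell_dim K (\<sigma> (low N R j)))"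
proof -
  have "bd (cell_dim K (\<sigma> j)) (z j) (\<sigma> (low N R j)) \<noteq> 0"
    using bd_z[OF assms(1)] low_props[OF assms(2)] by simp
  then obtain s where "s \<in> cells K" "cell_dim K s = cell_dim K (\<sigma> j)" "incidence K s (\<sigma> (low N R j)) \<noteq> 0"
    unfolding cellular_boundary_def using sum_nonzero_imp by fastforce
  then show ?thesis
    using incidence_dim by metis
qed

text \<open>Triangular elimination from the last cell downwards. The second conjunct keeps track of
  the leading coefficient, by which a nonzero top coefficient of a chain is recognized in the
  expansion; cells are numbered from \<open>1\<close>, hence the guard
  \<open>p \<noteq> 0\<close>.\<close>

lemma chains_expand:
  assumes "c \<in> chains p q" "p \<le> N"
  shows "\<exists>a. c = (\<lambda>s. \<Sum>i | i \<in> {1..p} \<and> cell_dim K (\<sigma> i) = q. a i * z i s) \<and>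
      (p \<noteq> 0 \<longrightarrow> cell_dim K (\<sigma> p) = q \<longrightarrow> a p = c (\<sigma> p))"
  using assms
proof (induction p arbitrary: c)
  case 0
  then show ?case
    by (auto simp: chains_def fun_eq_iff)
next
  case (Suc p)
  let ?I = "\<lambda>p. {i. i \<in> {1..p} \<and> cell_dim K (\<sigma> i) = q}"
  show ?case
  proof (cases "cell_dim K (\<sigma> (Suc p)) = q")
    case False
    then have "?I (Suc p) = ?I p"
      by (auto simp: le_Suc_eq)
    moreover have "c \<in> chains p q"
      using chains_zero[OF Suc.prems(1), of "\<sigma> (Suc p)"] False by (intro chains_Suc[OF Suc.prems(1)]) simp
    ultimately show ?thesis
      using Suc.IH[of c] Suc.prems(2) False by auto
  next
    case True
    have p: "Suc p \<in> {1..N}"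
      using Suc.prems by simp
    \<comment> \<open>Subtracting this multiple of \<open>z (Suc p)\<close> clears the last
      coefficient, as the diagonal of \<open>V\<close> consists of ones.\<close>
    define x where "x = c (\<sigma> (Suc p))"
    have "(\<lambda>s. c s - x * z (Suc p) s) \<in> chains (Suc p) q"
      using function_subspace_diff[OF function_subspace_chains Suc.prems(1)
          function_subspaceD(3)[OF function_subspace_chains]] z_chains[OF p order_refl] True by blast
    then have "(\<lambda>s. c s - x * z (Suc p) s) \<in> chains p q"
      by (rule chains_Suc) (simp add: x_def z_cell[OF p p] V_diag[OF p])
    then obtain a where a: "(\<lambda>s. c s - x * z (Suc p) s) = (\<lambda>s. \<Sum>i\<in>?I p. a i * z i s)"
      using Suc.IH Suc.prems by fastforce
    have I: "?I (Suc p) = insert (Suc p) (?I p)"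
      using True by (auto simp: le_Suc_eq)
    have "c s = (\<Sum>i\<in>?I (Suc p). (a(Suc p := x)) i * z i s)" for s
    proof -
      have "(\<Sum>i\<in>?I p. (a(Suc p := x)) i * z i s) = (\<Sum>i\<in>?I p. a i * z i s)"
        by (intro sum.cong) auto
      then show ?thesis
        using fun_cong[OF a, of s] unfolding I by (subst sum.insert) (auto simp: algebra_simps)
    qed
    then have "c = (\<lambda>s. \<Sum>i\<in>?I (Suc p). (a(Suc p := x)) i * z i s)"
      by (rule ext)
    then show ?thesis
      by (intro exI[of _ "a(Suc p := x)"] conjI) (simp_all add: x_def)
  qed
qed

text \<open>Because the lows are distinct, exactly one column reaches the row of the largest low,
  and its entry there cannot cancel.\<close>

lemma reduced_columns_top:
  assumes T: "finite T" "T \<noteq> {}" "\<And>j. j \<in> T \<Longrightarrow> j \<in> {1..N} \<and> \<not> zero_column N R j \<and> a j \<noteq> 0"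
  obtains j where "j \<in> T" "(\<Sum>i\<in>T. a i * R (low N R j) i) \<noteq> 0"
    "\<And>r. r \<in> {1..N} \<Longrightarrow> low N R j < r \<Longrightarrow> (\<Sum>i\<in>T. a i * R r i) = 0"
proof -
  have "Max (low N R ` T) \<in> low N R ` T"
    using T(1,2) by (intro Max_in) auto
  then obtain j where j: "j \<in> T" "low N R j = Max (low N R ` T)"
    by auto
  have max: "low N R i \<le> low N R j" if "i \<in> T" for i
    unfolding j(2) using T(1) that by simp
  show ?thesis
  proof
    show "j \<in> T"
      by (rule j)
    have "R (low N R j) i = 0" if "i \<in> T - {j}" for i
    proof -
      have "low N R i < low N R j"
        using that max[of i] j(1) low_inj[of i j] T(3) by (metis DiffD1 DiffD2 le_neq_implies_less singletonI)
      then show ?thesis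
        using that low_props T(3) j(1) by (metis DiffD1)
    qed
    then have "(\<Sum>i\<in>T. a i * R (low N R j) i) = a j * R (low N R j) j"
      using T(1) j(1) by (subst sum.remove[of _ j]) auto
    then show "(\<Sum>i\<in>T. a i * R (low N R j) i) \<noteq> 0"
      using T(3)[OF j(1)] low_props(2) by simp
    show "(\<Sum>i\<in>T. a i * R r i) = 0" if "r \<in> {1..N}" "low N R j < r" for r
      using that max low_props(3) T(3) by (intro sum.neutral ballI) (metis le_less_trans mult_zero_right)
  qed
qed

section \<open>Elimination on the largest index of a cycle\<close>

lemma bd_combination:
  fixes a :: "nat \<Rightarrow> 'k"
  assumes "I \<subseteq> {i \<in> {1..N}. cell_dim K (\<sigma> i) = q}" "r \<in> {1..N}"
  shows "bd q (\<lambda>s. \<Sum>i\<in>I. a i * z i s) (\<sigma> r)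
    = (\<Sum>i | i \<in> I \<and> \<not> zero_column N R i \<and> a i \<noteq> 0. a i * R r i)"
proof -
  have I: "finite I"
    using assms(1) finite_subset by fastforce
  have "bd q (\<lambda>s. \<Sum>i\<in>I. a i * z i s) (\<sigma> r) = (\<Sum>i\<in>I. a i * R r i)"
    unfolding bd_sum using assms bd_z by (intro sum.cong refl) auto
  also have "\<dots> = (\<Sum>i | i \<in> I \<and> \<not> zero_column N R i \<and> a i \<noteq> 0. a i * R r i)"
    using I assms(2) by (intro sum.mono_neutral_right) (auto simp: zero_column_def)
  finally show ?thesis .
qed

text \<open>If column \<open>m\<close> were nonzero, the expansion of \<open>c\<close> would contain
  it with nonzero coefficient, and \<open>reduced_columns_top\<close> would give a nonzero entry of
  the boundary of \<open>c\<close>.\<close>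

lemma cycle_top_positive:
  assumes c: "c \<in> cycles m q" and m: "m \<in> {1..N}" and nz: "c (\<sigma> m) \<noteq> 0"
  shows "cell_dim K (\<sigma> m) = q" "zero_column N R m"
proof -
  have chain: "c \<in> chains m q" and cycle: "bd q c = (\<lambda>t. 0)"
    using c by (auto simp: cycles_def)
  show dim: "cell_dim K (\<sigma> m) = q"
    using chain nz by (auto simp: chains_def)
  let ?I = "{i. i \<in> {1..m} \<and> cell_dim K (\<sigma> i) = q}"
  obtain a where a: "c = (\<lambda>s. \<Sum>i\<in>?I. a i * z i s)" "a m = c (\<sigma> m)"
    using chains_expand[OF chain] m dim by auto
  show "zero_column N R m"
  proof (rule ccontr)
    assume "\<not> zero_column N R m"
    define T where "T = {i \<in> ?I. \<not> zero_column N R i \<and> a i \<noteq> 0}"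
    have T: "finite T" "m \<in> T"
      using \<open>\<not> zero_column N R m\<close> m dim a(2) nz by (auto simp: T_def)
    then have "T \<noteq> {}"
      by blast
    moreover have "j \<in> {1..N} \<and> \<not> zero_column N R j \<and> a j \<noteq> 0" if "j \<in> T" for j
      using that m by (auto simp: T_def)
    ultimately obtain j where j: "j \<in> T" "(\<Sum>i\<in>T. a i * R (low N R j) i) \<noteq> 0"
      using reduced_columns_top[OF T(1)] by metis
    moreover have "low N R j \<in> {1..N}"
      using j(1) low_props(1) by (auto simp: T_def)
    moreover have "?I \<subseteq> {i \<in> {1..N}. cell_dim K (\<sigma> i) = q}"
      using m by auto
    ultimately have "bd q c (\<sigma> (low N R j)) \<noteq> 0"
      using bd_combination[of ?I q "low N R j" a] by (simp add: a(1) T_def)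
    then show False
      using cycle by simp
  qed
qed

lemma cycles_Suc: "c \<in> cycles (Suc m) q \<Longrightarrow> c (\<sigma> (Suc m)) = 0 \<Longrightarrow> c \<in> cycles m q"
  using chains_Suc by (auto simp: cycles_def)

lemma function_subspace_cycles: "function_subspace (cycles p q)"
  using function_subspaceD[OF function_subspace_chains[of p q]]
  by (auto simp: function_subspace_def cycles_def bd_add bd_smult bd_zero)

lemma bd_cycles: "b \<in> chains p (Suc q) \<Longrightarrow> p \<le> N \<Longrightarrow> bd (Suc q) b \<in> cycles p q"
  by (simp add: cycles_def bd_chains bd_bd)

lemma z_cycles:
  "i \<in> {1..N} \<Longrightarrow> zero_column N R i \<Longrightarrow> i \<le> p \<Longrightarrow> z i \<in> cycles p (cell_dim K (\<sigma> i))"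
  by (simp add: cycles_def z_chains bd_z_zero_column)

text \<open>Two bounds are kept apart: \<open>m\<close> bounds the support and decreases, while
  \<open>p\<close> fixes the active set and the stage of \<open>b\<close>. The boundaries used for
  elimination come from chains \<open>z j\<close> with \<open>j \<le> p\<close>, where
  \<open>j\<close> may exceed \<open>m\<close>.\<close>

lemma active_span:
  assumes "c \<in> cycles m q" "m \<le> p" "p \<le> N"
  shows "\<exists>a. \<exists>b\<in>chains p (Suc q). c = (\<lambda>s. (\<Sum>i\<in>active_set K N \<sigma> R q p. a i * z i s) + bd (Suc q) b s)"
  using assms
proof (induction m arbitrary: c)
  case 0
  then have "c = (\<lambda>s. 0)"
    by (auto simp: cycles_def chains_def)
  then show ?case
    by (intro exI[of _ "\<lambda>i. 0"] bexI[of _ "\<lambda>s. 0"]) (auto simp: bd_zero chains_def)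
next
  case (Suc m)
  let ?A = "active_set K N \<sigma> R q p"
  have A: "finite ?A"
    by (simp add: active_set_def)
  show ?case
  proof (cases "c (\<sigma> (Suc m)) = 0")
    case True
    then show ?thesis
      using Suc.IH[OF cycles_Suc] Suc.prems by auto
  next
    case False
    have m: "Suc m \<in> {1..N}" and mp: "m \<le> p"
      using Suc.prems by simp_all
    note pos = cycle_top_positive[OF Suc.prems(1) m False]
    define x where "x = c (\<sigma> (Suc m))"
    show ?thesis
    proof (cases "Suc m \<in> ?A")
      case True
      have "(\<lambda>s. c s - x * z (Suc m) s) \<in> cycles (Suc m) q"
        using function_subspace_diff[OF function_subspace_cycles Suc.prems(1)
            function_subspaceD(3)[OF function_subspace_cycles]] z_cycles[OF m pos(2) order_refl] pos(1) by blast
      then have "(\<lambda>s. c s - x * z (Suc m) s) \<in> cycles m q"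
        by (rule cycles_Suc) (simp add: x_def z_cell[OF m m] V_diag[OF m])
      then obtain a b where ab: "b \<in> chains p (Suc q)"
        "(\<lambda>s. c s - x * z (Suc m) s) = (\<lambda>s. (\<Sum>i\<in>?A. a i * z i s) + bd (Suc q) b s)"
        using Suc.IH[OF _ mp Suc.prems(3)] by blast
      \<comment> \<open>The induction hypothesis may already use \<open>Suc m\<close>, as its sum
        runs over the whole active set; hence \<open>x\<close> is added to the coefficient
        there.\<close>
      have "c s = (\<Sum>i\<in>?A. (a(Suc m := a (Suc m) + x)) i * z i s) + bd (Suc q) b s" for s
      proof -
        have "(\<Sum>i\<in>?A - {Suc m}. (a(Suc m := a (Suc m) + x)) i * z i s) = (\<Sum>i\<in>?A - {Suc m}. a i * z i s)"
          by (intro sum.cong) auto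
        then have "(\<Sum>i\<in>?A. (a(Suc m := a (Suc m) + x)) i * z i s) = (\<Sum>i\<in>?A. a i * z i s) + x * z (Suc m) s"
          using sum.remove[OF A True, of "\<lambda>i. a i * z i s"]
            sum.remove[OF A True, of "\<lambda>i. (a(Suc m := a (Suc m) + x)) i * z i s"]
          by (simp add: algebra_simps)
        then show ?thesis
          using fun_cong[OF ab(2), of s] by (simp add: algebra_simps)
      qed
      then show ?thesis
        using ab(1) by blast
    next
      case False
      \<comment> \<open>The index \<open>Suc m\<close> is positive, of dimension \<open>q\<close>
        and at most \<open>p\<close>, so only an early partner can make it inactive.\<close>
      then have paired: "pair N R (Suc m) \<le> enat p"
        using m pos Suc.prems(2) unfolding active_set_def by (simp add: not_less)
      then have ex: "\<exists>j \<in> {1..N}. \<not> zero_column N R j \<and> low N R j = Suc m"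
      proof (rule contrapos_pp)
        assume "\<not> (\<exists>j \<in> {1..N}. \<not> zero_column N R j \<and> low N R j = Suc m)"
        then have "pair N R (Suc m) = \<infinity>"
          unfolding pair_def by (rule if_not_P)
        then show "\<not> pair N R (Suc m) \<le> enat p"
          by simp
      qed
      then obtain j where j: "j \<in> {1..N}" "\<not> zero_column N R j" "low N R j = Suc m"
        by blast
      have jp: "j \<le> p"
        using paired pair_low[OF j(1,2)] j(3) by simp
      have dim: "cell_dim K (\<sigma> j) = Suc q"
        using dim_low[OF j(1,2)] j(3) pos(1) by simp
      have bz: "bd (Suc q) (z j) (\<sigma> r) = R r j" if "r \<in> {1..N}" for r
        using bd_z[OF j(1) that] dim by simp
      \<comment> \<open>Scales the entry of column \<open>j\<close> at its low, which is
        \<open>Suc m\<close>, to the coefficient that must be cleared.\<close>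
      define y where "y = x / R (Suc m) j"
      have Rnz: "R (Suc m) j \<noteq> 0"
        using low_props(2)[OF j(2)] j(3) by simp
      have zj: "z j \<in> chains p (Suc q)"
        using z_chains[OF j(1) jp] dim by simp
      have cyc: "bd (Suc q) (z j) \<in> cycles N q"
        using z_chains[OF j(1)] j(1) dim by (intro bd_cycles) auto
      \<comment> \<open>Although \<open>z j\<close> may involve later cells, its boundary has no
        entry below the low of column \<open>j\<close> in the matrix, so no index beyond
        \<open>Suc m\<close> occurs.\<close>
      have "bd (Suc q) (z j) \<in> cycles (Suc m) q"
      proof -
        have "s \<in> \<sigma> ` {1..Suc m}" if nz: "bd (Suc q) (z j) s \<noteq> 0" for s
        proof -
          obtain r where r: "r \<in> {1..N}" "s = \<sigma> r"
            using nz cyc by (auto simp: cycles_def chains_def)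
          then have "\<not> Suc m < r"
            using nz bz low_props(3)[OF j(2), of r] j(3) by auto
          then show ?thesis
            using r by auto
        qed
        then show ?thesis
          using cyc by (auto simp: cycles_def chains_def)
      qed
      then have "(\<lambda>s. c s - y * bd (Suc q) (z j) s) \<in> cycles (Suc m) q"
        by (intro function_subspace_diff[OF function_subspace_cycles Suc.prems(1)]
            function_subspaceD(3)[OF function_subspace_cycles])
      then have "(\<lambda>s. c s - y * bd (Suc q) (z j) s) \<in> cycles m q"
        by (rule cycles_Suc) (simp add: bz[OF m] y_def x_def Rnz)
      then obtain a b where ab: "b \<in> chains p (Suc q)"
        "(\<lambda>s. c s - y * bd (Suc q) (z j) s) = (\<lambda>s. (\<Sum>i\<in>?A. a i * z i s) + bd (Suc q) b s)"
        using Suc.IH[OF _ mp Suc.prems(3)] by blast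
      have "c s = (\<Sum>i\<in>?A. a i * z i s) + bd (Suc q) (\<lambda>s. b s + y * z j s) s" for s
        using fun_cong[OF ab(2), of s] by (simp add: bd_add bd_smult algebra_simps)
      moreover have "(\<lambda>s. b s + y * z j s) \<in> chains p (Suc q)"
        by (intro function_subspaceD(2,3)[OF function_subspace_chains] ab(1) zj)
      ultimately show ?thesis
        by blast
    qed
  qed
qed

text \<open>The largest index is computed on both sides of the equation. On the left it is an active
  index \<open>m\<close>; on the right it is the low of a column \<open>j \<le> p\<close>. Then
  \<open>pair N R m\<close> is \<open>j\<close>, contradicting activity at \<open>p\<close>.\<close>

lemma active_independent:
  assumes b: "b \<in> chains p (Suc q)" and p: "p \<le> N"
    and eq: "(\<lambda>s. \<Sum>i\<in>active_set K N \<sigma> R q p. a i * z i s) = bd (Suc q) b"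
    and i: "i \<in> active_set K N \<sigma> R q p"
  shows "a i = 0"
proof (rule ccontr)
  let ?A = "active_set K N \<sigma> R q p"
  assume "a i \<noteq> 0"
  define S where "S = {i \<in> ?A. a i \<noteq> 0}"
  have S: "finite S" "S \<noteq> {}"
    using \<open>a i \<noteq> 0\<close> i by (auto simp: S_def active_set_def)
  define m where "m = Max S"
  have mS: "m \<in> S" and max: "\<And>i. i \<in> S \<Longrightarrow> i \<le> m"
    using S by (auto simp: m_def)
  then have m: "m \<in> {1..N}" "m \<in> ?A" "a m \<noteq> 0"
    by (auto simp: S_def active_set_def)
  have AN: "?A \<subseteq> {1..N}" "finite ?A"
    by (auto simp: active_set_def)
  \<comment> \<open>Left side: with \<open>V\<close> unitriangular, the largest index in
    \<open>S\<close> is the largest one with a nonzero entry.\<close>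
  have lhs: "bd (Suc q) b (\<sigma> r) = (\<Sum>i\<in>S. a i * V r i)" if r: "r \<in> {1..N}" for r
  proof -
    have "bd (Suc q) b (\<sigma> r) = (\<Sum>i\<in>?A. a i * V r i)"
      unfolding fun_cong[OF eq, symmetric] using AN z_cell r by (intro sum.cong) auto
    also have "\<dots> = (\<Sum>i\<in>S. a i * V r i)"
      using AN by (intro sum.mono_neutral_right) (auto simp: S_def)
    finally show ?thesis .
  qed
  have SN: "S \<subseteq> {1..N}"
    using AN by (auto simp: S_def)
  have "(\<Sum>i\<in>S. a i * V m i) = a m * V m m"
  proof -
    have "V m i = 0" if "i \<in> S - {m}" for i
      using that max[of i] SN V_upper[OF m(1), of i] by auto
    then show ?thesis
      using S(1) mS by (subst sum.remove[of _ m]) auto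
  qed
  then have top: "bd (Suc q) b (\<sigma> m) \<noteq> 0"
    using lhs[OF m(1)] V_diag[OF m(1)] m(3) by simp
  have above: "bd (Suc q) b (\<sigma> r) = 0" if r: "r \<in> {1..N}" "m < r" for r
  proof -
    have "V r i = 0" if "i \<in> S" for i
      using that max[of i] SN V_upper[OF r(1), of i] r(2) by auto
    then show ?thesis
      using lhs[OF r(1)] by simp
  qed
  let ?I = "{j. j \<in> {1..p} \<and> cell_dim K (\<sigma> j) = Suc q}"
  obtain e where e: "b = (\<lambda>s. \<Sum>j\<in>?I. e j * z j s)"
    using chains_expand[OF b p] by blast
  \<comment> \<open>Right side: only the nonzero columns survive the boundary, and they satisfy the
    hypotheses of \<open>reduced_columns_top\<close>.\<close>
  define T where "T = {j \<in> ?I. \<not> zero_column N R j \<and> e j \<noteq> 0}"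
  have "?I \<subseteq> {j \<in> {1..N}. cell_dim K (\<sigma> j) = Suc q}"
    using p by auto
  from bd_combination[OF this]
  have rhs: "bd (Suc q) b (\<sigma> r) = (\<Sum>j\<in>T. e j * R r j)" if "r \<in> {1..N}" for r
    using that by (simp add: e T_def)
  have T: "finite T" "T \<noteq> {}"
    using top rhs[OF m(1)] by (simp add: T_def, metis sum.empty)
  have TN: "j \<in> {1..N} \<and> \<not> zero_column N R j \<and> e j \<noteq> 0" if "j \<in> T" for j
    using that p by (auto simp: T_def)
  obtain j where j: "j \<in> T" "(\<Sum>i\<in>T. e i * R (low N R j) i) \<noteq> 0"
    "\<And>r. r \<in> {1..N} \<Longrightarrow> low N R j < r \<Longrightarrow> (\<Sum>i\<in>T. e i * R r i) = 0"
    by (rule reduced_columns_top[OF T, of e], erule TN, rule that)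
  have low: "low N R j \<in> {1..N}"
    using low_props(1) TN[OF j(1)] by blast
  have "low N R j = m"
    using above[OF low] top rhs[OF low] rhs[OF m(1)] j(2) j(3)[OF m(1)] by (metis linorder_neqE_nat)
  then have "pair N R m = enat j"
    using pair_low TN[OF j(1)] by blast
  moreover have "enat p < pair N R m"
    using m(2) by (simp add: active_set_def)
  ultimately show False
    using j(1) by (simp add: T_def)
qed

end

section \<open>Classes of active birth cycles in the homology of a stage\<close>

theorem theorem2p10:
  fixes K :: "'a cw_complex"
    and f :: "'a set \<Rightarrow> real"
    and \<sigma> :: "nat \<Rightarrow> 'a set"
    and R V :: "nat \<Rightarrow> nat \<Rightarrow> 'k::field"
    and N p q :: nat
  assumes "finite_cw_complex K"
    and "filtration_function K f"
    and "compatible_order K f N \<sigma>"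
    and "reduction K N \<sigma> R V"
    and "p \<le> N"
  defines "H \<equiv> cellular_homology K (stage_cells \<sigma> p) q :: ('k, ('a set \<Rightarrow> 'k) set) module"
    and "cls \<equiv> \<lambda>i. homology_class K (stage_cells \<sigma> p) q (birth_cycle K \<sigma> V i)"
  shows "vectorspace class_ring H \<and>
         inj_on cls (active_set K N \<sigma> R q p) \<and>
         vectorspace.basis class_ring H (cls ` active_set K N \<sigma> R q p)"
proof -
  interpret cw_reduction K f \<sigma> N R V
    using assms by unfold_locales
  define B where "B = bd (Suc q) ` chains p (Suc q)"
  \<comment> \<open>Dictionary between the homology records and the plain sets of chains, cycles and
    boundaries used in the elimination.\<close>
  have chains: "carrier (cellular_chains K (stage_cells \<sigma> p) r) = chains p r" for r
    by (auto simp: cellular_chains_def chains_def stage_cells_def)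
  have cycles: "cellular_cycles K (stage_cells \<sigma> p) q = function_module (cycles p q)"
    unfolding cellular_cycles_def chains
    by (simp add: cellular_chains_def function_module_def cycles_def)
  have boundaries: "cellular_boundaries K (stage_cells \<sigma> p) q = B"
    by (simp add: cellular_boundaries_def chains B_def)
  interpret quotient: function_quotient "cycles p q" B
  proof
    show "function_subspace (cycles p q)"
      by (rule function_subspace_cycles)
    show "B \<subseteq> cycles p q"
      using bd_cycles assms(5) by (auto simp: B_def)
    note closed = function_subspaceD[OF function_subspace_chains[of p "Suc q"]]
    show "function_subspace B"
      unfolding function_subspace_def B_def
    proof (intro conjI ballI allI)
      show "(\<lambda>s. 0) \<in> bd (Suc q) ` chains p (Suc q)"
        using closed(1) by (rule image_eqI[rotated]) (simp add: bd_zero)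
      fix x assume "x \<in> bd (Suc q) ` chains p (Suc q)"
      then obtain u where u: "u \<in> chains p (Suc q)" "x = bd (Suc q) u"
        by blast
      show "(\<lambda>s. a * x s) \<in> bd (Suc q) ` chains p (Suc q)" for a
        using closed(3)[OF u(1)] by (rule image_eqI[rotated]) (simp add: bd_smult u(2))
      fix y assume "y \<in> bd (Suc q) ` chains p (Suc q)"
      then obtain v where v: "v \<in> chains p (Suc q)" "y = bd (Suc q) v"
        by blast
      show "(\<lambda>s. x s + y s) \<in> bd (Suc q) ` chains p (Suc q)"
        using closed(2)[OF u(1) v(1)] by (rule image_eqI[rotated]) (simp add: bd_add u(2) v(2))
    qed
  qed
  let ?A = "active_set K N \<sigma> R q p"
  \<comment> \<open>With these identifications homology is a quotient of function spaces, so
    spanning and independence modulo \<open>B\<close> suffice.\<close>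
  have H: "H = quotient.Q"
    by (simp add: H_def cellular_homology_def cycles boundaries)
  have cls: "cls = (\<lambda>i. quotient.coset (z i))"
    by (simp add: cls_def homology_class_def cycles boundaries z_def)
  have "finite ?A"
    by (simp add: active_set_def)
  moreover have "z i \<in> cycles p q" if "i \<in> ?A" for i
    using that z_cycles[of i p] by (auto simp: active_set_def)
  moreover have "\<exists>a. (\<lambda>s. c s - (\<Sum>i\<in>?A. a i * z i s)) \<in> B" if c: "c \<in> cycles p q" for c
  proof -
    obtain a b where "b \<in> chains p (Suc q)" "c = (\<lambda>s. (\<Sum>i\<in>?A. a i * z i s) + bd (Suc q) b s)"
      using active_span[OF c order_refl assms(5)] by blast
    then have "(\<lambda>s. c s - (\<Sum>i\<in>?A. a i * z i s)) \<in> B"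
      by (simp add: B_def)
    then show ?thesis
      by blast
  qed
  moreover have "a i = 0" if "(\<lambda>s. \<Sum>i\<in>?A. a i * z i s) \<in> B" "i \<in> ?A" for a i
  proof -
    obtain b where "b \<in> chains p (Suc q)" "(\<lambda>s. \<Sum>i\<in>?A. a i * z i s) = bd (Suc q) b"
      using \<open>_ \<in> B\<close> unfolding B_def by blast
    then show ?thesis
      using active_independent assms(5) that(2) by blast
  qed
  ultimately show ?thesis
    unfolding H cls using quotient.vectorspace_Q quotient.basis_Q[of ?A z] by blast
qed

end
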